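(* Let $M$ be a closed surface with a triangulation $\mathcal{T}=\{V,E,F\}$ and let $I:E\rightarrow(-1,+\infty)$ be an inversive distance satisfying $$I_{ij}+I_{ik}I_{jk}\geq 0,\quad I_{ik}+I_{ij}I_{jk}\geq 0,\quad I_{jk}+I_{ij}I_{ik}\geq 0$$ for every triangle $\triangle ijk\in F$. Then: (1) A Euclidean inversive distance circle packing metric on $(M,\mathcal{T},I)$ is determined by its combinatorial curvature $K:V\rightarrow\mathbb{R}$ up to scaling. That is, if $r,r'$ are two Euclidean inversive distance circle packing metrics with $K(r)=K(r')$, then there is $\lambda>0$ with $r'=\lambda r$. (2) A hyperbolic inversive distance circle packing metric on $(M,\mathcal{T},I)$ is determined by its combinatorial curvature $K:V\rightarrow\mathbb{R}$. That is, if $r,r'$ are two hyperbolic inversive distance circle packing metrics with $K(r)=K(r')$, then $r=r'$.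
   Context: $M$ is a closed surface (connected, as usual) with a triangulation $\mathcal{T}=\{V,E,F\}$, where $V,E,F$ are the sets of vertices, edges and faces; the vertices are $1,\dots,N$. $I_{ij}$ denotes the value of $I:E\to(-1,+\infty)$ on the edge $\{ij\}$. For $r:V\to(0,+\infty)$, each edge $\{ij\}$ is assigned the length $$l_{ij}=\sqrt{r_i^2+r_j^2+2r_ir_jI_{ij}}$$ in the Euclidean background geometry, and $$l_{ij}=\cosh^{-1}\big(\cosh r_i\cosh r_j+I_{ij}\sinh r_i\sinh r_j\big)$$ in the hyperbolic background geometry. The function $r$ is called a (Euclidean, resp. hyperbolic) inversive distance circle packing metric if for every face $\triangle ijk\in F$ the three lengths $l_{ij},l_{ik},l_{jk}$ satisfy the strict triangle inequalities. In this case each face is realized as a Euclidean (resp. hyperbolic) triangle with these edge lengths; let $\theta_i^{jk}$ denote its inner angle at the vertex $i$. The combinatorial curvature is $$K_i=2\pi-\sum_{\triangle ijk\in F}\theta_i^{jk},$$ the sum being over all faces having $i$ as a vertex. *)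

theory Defs
  imports "HOL-Analysis.Analysis"
begin

section \<open>Triangulated closed surfaces\<close>

definition closed_surface :: "'m topology \<Rightarrow> bool" where
  "closed_surface M \<longleftrightarrow>
     topspace M \<noteq> {} \<and> connected_space M \<and> compact_space M \<and> Hausdorff_space M \<and>
     (\<forall>x\<in>topspace M. \<exists>U. openin M U \<and> x \<in> U \<and>
        subtopology M U homeomorphic_space (euclidean :: (real^2) topology))"

text \<open>The geometric realization of the simplicial complex whose maximal simplices are the members
  of \<open>F\<close>, in barycentric coordinates. For finitely many vertices, the product topology that
  \<open>'v \<Rightarrow> real\<close> carries induces the usual topology on it.\<close>

definition realization :: "'v set set \<Rightarrow> ('v \<Rightarrow> real) set" where
  "realization F = (\<Union>f\<in>F. {x. (\<forall>v. 0 \<le> x v) \<and> (\<forall>v. v \<notin> f \<longrightarrow> x v = 0) \<and> (\<Sum>v\<in>f. x v) = 1})"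

text \<open>Edges and faces are represented by their sets of vertices, i.e. the edge \<open>ij\<close> is the set
  \<open>{i,j}\<close> and the face \<open>ijk\<close> is the set \<open>{i,j,k}\<close>.\<close>

definition triangulation_of ::
  "'m topology \<Rightarrow> 'v set \<Rightarrow> 'v set set \<Rightarrow> 'v set set \<Rightarrow> bool" where
  "triangulation_of M V E F \<longleftrightarrow>
     finite V \<and> V = \<Union>F \<and> (\<forall>f\<in>F. card f = 3) \<and>
     E = {e. card e = 2 \<and> (\<exists>f\<in>F. e \<subseteq> f)} \<and>
     top_of_set (realization F) homeomorphic_space M"

section \<open>Angles in the Euclidean and in the hyperbolic plane\<close>

text \<open>In both planes the first point is the apex of the angle.\<close>

definition eucl_angle :: "real^2 \<Rightarrow> real^2 \<Rightarrow> real^2 \<Rightarrow> real" where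
  "eucl_angle p q r = arccos (((q - p) \<bullet> (r - p)) / (norm (q - p) * norm (r - p)))"

text \<open>The hyperbolic plane is the upper sheet of the hyperboloid in Minkowski space.\<close>

definition lorentz :: "(real^2) \<times> real \<Rightarrow> (real^2) \<times> real \<Rightarrow> real" where
  "lorentz p q = fst p \<bullet> fst q - snd p * snd q"

definition hyp_plane :: "((real^2) \<times> real) set" where
  "hyp_plane = {p. lorentz p p = -1 \<and> snd p > 0}"

definition hyp_dist :: "(real^2) \<times> real \<Rightarrow> (real^2) \<times> real \<Rightarrow> real" where
  "hyp_dist p q = arcosh (- lorentz p q)"

text \<open>The component of \<open>q\<close> that is Lorentz-orthogonal to \<open>p\<close>. It is tangent to the hyperboloid
  at \<open>p\<close> and points in the direction of the geodesic from \<open>p\<close> to \<open>q\<close>.\<close>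

definition hyp_direction :: "(real^2) \<times> real \<Rightarrow> (real^2) \<times> real \<Rightarrow> (real^2) \<times> real" where
  "hyp_direction p q = q + lorentz p q *\<^sub>R p"

definition hyp_angle :: "(real^2) \<times> real \<Rightarrow> (real^2) \<times> real \<Rightarrow> (real^2) \<times> real \<Rightarrow> real" where
  "hyp_angle p q r =
     (let u = hyp_direction p q; w = hyp_direction p r
      in arccos (lorentz u w / (sqrt (lorentz u u) * sqrt (lorentz w w))))"

section \<open>Inner angles of faces and combinatorial curvature\<close>

text \<open>The inner angle at the vertex \<open>i\<close> of the face \<open>f\<close>, when \<open>f\<close> is realized as a triangle in
  the plane \<open>X\<close> (with distance \<open>d\<close> and angle \<open>ang\<close>) whose side lengths are given by \<open>l\<close>. It is
  well defined if \<open>l\<close> satisfies the strict triangle inequalities on \<open>f\<close>.\<close>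

definition inner_angle ::
  "'p set \<Rightarrow> ('p \<Rightarrow> 'p \<Rightarrow> real) \<Rightarrow> ('p \<Rightarrow> 'p \<Rightarrow> 'p \<Rightarrow> real) \<Rightarrow>
   ('v \<Rightarrow> 'v \<Rightarrow> real) \<Rightarrow> 'v set \<Rightarrow> 'v \<Rightarrow> real" where
  "inner_angle X d ang l f i =
     (THE \<theta>. \<exists>P j k. f = {i, j, k} \<and> P ` f \<subseteq> X \<and>
        (\<forall>u\<in>f. \<forall>v\<in>f. u \<noteq> v \<longrightarrow> d (P u) (P v) = l u v) \<and>
        \<theta> = ang (P i) (P j) (P k))"

definition curvature :: "('v set \<Rightarrow> 'v \<Rightarrow> real) \<Rightarrow> 'v set set \<Rightarrow> 'v \<Rightarrow> real" where
  "curvature \<theta> F i = 2 * pi - (\<Sum>f | f \<in> F \<and> i \<in> f. \<theta> f i)"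

section \<open>Inversive distance circle packing metrics\<close>

definition strict_triangle_ineqs :: "'v set set \<Rightarrow> ('v \<Rightarrow> 'v \<Rightarrow> real) \<Rightarrow> bool" where
  "strict_triangle_ineqs F l \<longleftrightarrow>
     (\<forall>i j k. {i, j, k} \<in> F \<longrightarrow>
        l i j < l i k + l j k \<and> l i k < l i j + l j k \<and> l j k < l i j + l i k)"

definition eucl_length :: "('v set \<Rightarrow> real) \<Rightarrow> ('v \<Rightarrow> real) \<Rightarrow> 'v \<Rightarrow> 'v \<Rightarrow> real" where
  "eucl_length I r i j = sqrt ((r i)\<^sup>2 + (r j)\<^sup>2 + 2 * r i * r j * I {i, j})"

definition hyp_length :: "('v set \<Rightarrow> real) \<Rightarrow> ('v \<Rightarrow> real) \<Rightarrow> 'v \<Rightarrow> 'v \<Rightarrow> real" where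
  "hyp_length I r i j = arcosh (cosh (r i) * cosh (r j) + I {i, j} * sinh (r i) * sinh (r j))"

definition eucl_packing_metric ::
  "'v set \<Rightarrow> 'v set set \<Rightarrow> ('v set \<Rightarrow> real) \<Rightarrow> ('v \<Rightarrow> real) \<Rightarrow> bool" where
  "eucl_packing_metric V F I r \<longleftrightarrow>
     (\<forall>v\<in>V. r v > 0) \<and> strict_triangle_ineqs F (eucl_length I r)"

definition hyp_packing_metric ::
  "'v set \<Rightarrow> 'v set set \<Rightarrow> ('v set \<Rightarrow> real) \<Rightarrow> ('v \<Rightarrow> real) \<Rightarrow> bool" where
  "hyp_packing_metric V F I r \<longleftrightarrow>
     (\<forall>v\<in>V. r v > 0) \<and> strict_triangle_ineqs F (hyp_length I r)"

definition eucl_curvature ::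
  "'v set set \<Rightarrow> ('v set \<Rightarrow> real) \<Rightarrow> ('v \<Rightarrow> real) \<Rightarrow> 'v \<Rightarrow> real" where
  "eucl_curvature F I r = curvature (inner_angle UNIV dist eucl_angle (eucl_length I r)) F"

definition hyp_curvature ::
  "'v set set \<Rightarrow> ('v set \<Rightarrow> real) \<Rightarrow> ('v \<Rightarrow> real) \<Rightarrow> 'v \<Rightarrow> real" where
  "hyp_curvature F I r = curvature (inner_angle hyp_plane hyp_dist hyp_angle (hyp_length I r)) F"

end

theory Submission
  imports Defs
begin

text \<open>
  The theorem reduces to a monotonicity property of a single face. Use the coordinate
  \<open>u = ln r\<close> in the Euclidean and \<open>u = - arsinh (1 / sinh r)\<close>, which equals \<open>ln (tanh (r / 2))\<close>, in
  the hyperbolic case. In these coordinates the angles \<open>\<theta>\<^sub>i\<close> of a face have a symmetric Jacobian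
  matrix. Suppose that for every face and for two admissible triples of radii
  \<open>\<Sum>\<^sub>i (u'\<^sub>i - u\<^sub>i) (\<theta>'\<^sub>i - \<theta>\<^sub>i) \<le> 0\<close>, with equality only for \<open>u' - u\<close> constant (Euclidean) or \<open>u' = u\<close> (hyperbolic). Summing over all
  faces and exchanging the summations turns the left-hand side into
  \<open>\<Sum>\<^sub>v (u' v - u v) (K v - K' v)\<close>, which vanishes for equal curvatures (\<open>curvature_energy\<close>). So
  equality holds on every face. In the Euclidean case the ratio of the radii is therefore constant on
  each face, and as the surface is connected, it is constant (\<open>constant_of_constant_on_faces\<close>).

  The face property (\<open>eucl_face_monotone\<close>, \<open>hyp_face_monotone\<close>) would follow by integrating along the
  segment from \<open>u\<close> to \<open>u'\<close>, if the Jacobian matrix is negative definite, modulo constants in the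
  Euclidean case. The segment may however leave the set where the triangle inequalities hold, which
  need not be convex. Following Luo, the angles are extended by truncating the cosine in the law of cosines to
  \<open>[-1, 1]\<close>. This extension is continuous. As soon as the triangle inequalities fail, all three cosines
  have absolute value at least 1, so every extended angle is 0 or \<open>\<pi>\<close>, and
  \<open>\<Sum>\<^sub>i (u'\<^sub>i - u\<^sub>i) \<theta>\<^sub>i\<close> has only finitely many values there. A continuous function that has
  negative derivative outside a set on which it takes finitely many values cannot increase
  (\<open>decreasing_of_finite_exceptional_values\<close>), and it decreases strictly at the start, which is
  admissible.

  It remains to prove definiteness at an admissible point. Write \<open>a, b, c\<close> for the inversive distances
  on the edges \<open>12, 23, 13\<close>. The quadratic form is a sum over the edges, in which the edge opposite to
  vertex \<open>k\<close> contributes a positive semidefinite form (definite in the hyperbolic case) times a weight, and the weight has the sign of a height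
  \<open>h\<^sub>k\<close>, the signed distance of the radical centre from that edge up to a positive factor. The
  hypotheses on the inversive distances have two main consequences. At most one of the three heights is nonpositive
  (\<open>at_most_one_nonpos_height\<close>), and the derivative of the three lengths with respect to the three
  radii has positive determinant (\<open>length_jacobian_pos\<close>). In the Euclidean case this means that the
  second elementary symmetric polynomial of the three weights is positive, which is definiteness modulo
  constants. In the hyperbolic case Sylvester's criterion requires in addition a positive
  \<open>2 \<times> 2\<close> minor. If all weights are nonnegative the form is clearly definite; if the weight of the
  edge \<open>12\<close> is negative, one of the two minors that contain the third row is shown to be positive
  by comparing the angles at 1 and 2 and the rates at which the edges grow with the radii
  (\<open>hyp_form_pos_of_two_weights\<close>).
\<close>

section \<open>Inversive distances on the edges of a triangle\<close>

text \<open>The inversive distances of one face: \<open>a\<close>, \<open>b\<close>, \<open>c\<close> belong to the edges \<open>12\<close>, \<open>23\<close>, \<open>13\<close>.\<close>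

locale inversive_triple =
  fixes a b c :: real
  assumes gt: "-1 < a" "-1 < b" "-1 < c"
    and struct: "0 \<le> b + a * c" "0 \<le> c + a * b" "0 \<le> a + b * c"

lemma inversive_triple_swap12: "inversive_triple a b c \<Longrightarrow> inversive_triple a c b"
  by (auto simp: inversive_triple_def mult_ac)

lemma inversive_triple_swap23: "inversive_triple a b c \<Longrightarrow> inversive_triple c b a"
  by (auto simp: inversive_triple_def mult_ac)

lemma inversive_triple_swap13: "inversive_triple a b c \<Longrightarrow> inversive_triple b a c"
  by (auto simp: inversive_triple_def mult_ac)

context inversive_triple begin

text \<open>Up to a positive factor this is the determinant of the derivative of the three edge lengths with
  respect to the three radii. In the Euclidean case \<open>k\<^sub>i\<close> is the radius \<open>r\<^sub>i\<close>,
  and in the hyperbolic case a multiple of \<open>coth r\<^sub>i\<close>. Collecting the terms by the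
  three structure conditions leaves a sum of squares and the term with \<open>(1 + a) (1 + b) (1 + c)\<close>.\<close>

lemma length_jacobian_pos:
  assumes "0 < k1" "0 < k2" "0 < k3"
  shows "0 < (k2 + a * k1) * (k3 + b * k2) * (k1 + c * k3) + (k1 + a * k2) * (k2 + b * k3) * (k3 + c * k1)"
proof -
  have "(k2 + a * k1) * (k3 + b * k2) * (k1 + c * k3) + (k1 + a * k2) * (k2 + b * k3) * (k3 + c * k1)
    = 2 * k1 * k2 * k3 * ((1 + a) * (1 + b) * (1 + c)) + (b + a * c) * (k1 * (k2 - k3)\<^sup>2)
      + (c + a * b) * (k2 * (k1 - k3)\<^sup>2) + (a + b * c) * (k3 * (k1 - k2)\<^sup>2)"
    by algebra
  moreover have "0 < 2 * k1 * k2 * k3 * ((1 + a) * (1 + b) * (1 + c))"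
    using assms gt by simp
  moreover have "0 \<le> (b + a * c) * (k1 * (k2 - k3)\<^sup>2)" "0 \<le> (c + a * b) * (k2 * (k1 - k3)\<^sup>2)"
    "0 \<le> (a + b * c) * (k3 * (k1 - k2)\<^sup>2)"
    using assms struct by simp_all
  ultimately show ?thesis by linarith
qed

text \<open>The left-hand sides are the heights of the radical centre over the edges \<open>23\<close> and \<open>13\<close>, up to
  positive factors. If both were nonpositive, then \<open>b, c \<ge> 1\<close>, and multiplying the two inequalities
  gives \<open>(a + b c)\<^sup>2 \<le> (b\<^sup>2 - 1) (c\<^sup>2 - 1) \<le> (b c - 1)\<^sup>2\<close>, that is \<open>a \<le> -1\<close>.\<close>

lemma at_most_one_nonpos_height:
  assumes k: "0 < k1" "0 < k2" "0 < k3"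
    and h1: "k1 * (1 - b\<^sup>2) + k2 * (a + b * c) + k3 * (c + a * b) \<le> 0"
    and h2: "k2 * (1 - c\<^sup>2) + k1 * (a + b * c) + k3 * (b + a * c) \<le> 0"
  shows False
proof -
  have p: "0 \<le> k3 * (c + a * b)" "0 \<le> k3 * (b + a * c)" "0 \<le> k2 * (a + b * c)" "0 \<le> k1 * (a + b * c)"
    using k struct by simp_all
  then have h1': "k2 * (a + b * c) \<le> k1 * (b\<^sup>2 - 1)" and h2': "k1 * (a + b * c) \<le> k2 * (c\<^sup>2 - 1)"
    using h1 h2 by (auto simp: algebra_simps)
  have "0 \<le> k1 * (b\<^sup>2 - 1)" "0 \<le> k2 * (c\<^sup>2 - 1)" using h1' h2' p by linarith+
  then have bc: "1 \<le> b\<^sup>2" "1 \<le> c\<^sup>2" using k by (simp_all add: zero_le_mult_iff)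
  then have "\<not> \<bar>b\<bar> < 1" "\<not> \<bar>c\<bar> < 1"
    using abs_square_less_1[of b] abs_square_less_1[of c] by linarith+
  then have b: "1 \<le> b" and c: "1 \<le> c" using gt by linarith+
  have "(k1 * k2) * (a + b * c)\<^sup>2 = (k2 * (a + b * c)) * (k1 * (a + b * c))"
    by (simp add: power2_eq_square)
  also have "\<dots> \<le> (k1 * (b\<^sup>2 - 1)) * (k2 * (c\<^sup>2 - 1))"
    by (intro mult_mono h1' h2') (use k bc p in auto)
  also have "\<dots> = (k1 * k2) * ((b\<^sup>2 - 1) * (c\<^sup>2 - 1))" by simp
  finally have "(a + b * c)\<^sup>2 \<le> (b\<^sup>2 - 1) * (c\<^sup>2 - 1)" using k by simp
  also have "\<dots> = (b * c - 1)\<^sup>2 - (b - c)\<^sup>2" by algebra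
  also have "\<dots> \<le> (b * c - 1)\<^sup>2" by simp
  finally have "a + b * c \<le> b * c - 1"
  proof (rule power2_le_imp_le)
    show "0 \<le> b * c - 1" using b c mult_mono[of 1 b 1 c] by simp
  qed
  then show False using gt by simp
qed

end

section \<open>Positive definite quadratic forms in three variables\<close>

text \<open>Sylvester's criterion, by completing the squares in \<open>v3\<close> and then in \<open>v1\<close>.\<close>

lemma positive_definite_3:
  fixes m11 m12 m13 m22 m23 m33 v1 v2 v3 :: real
  assumes m33: "0 < m33" and m2: "0 < m11 * m33 - m13\<^sup>2"
    and det: "0 < m11 * (m22 * m33 - m23\<^sup>2) - m12 * (m12 * m33 - m23 * m13) + m13 * (m12 * m23 - m22 * m13)"
    and v: "v1 \<noteq> 0 \<or> v2 \<noteq> 0 \<or> v3 \<noteq> 0"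
  shows "0 < m11 * v1\<^sup>2 + m22 * v2\<^sup>2 + m33 * v3\<^sup>2 + 2 * m12 * v1 * v2 + 2 * m13 * v1 * v3 + 2 * m23 * v2 * v3"
    (is "0 < ?q")
proof -
  define d where "d = m11 * m33 - m13\<^sup>2"
  define e where "e = m11 * (m22 * m33 - m23\<^sup>2) - m12 * (m12 * m33 - m23 * m13) + m13 * (m12 * m23 - m22 * m13)"
  define l3 where "l3 = m33 * v3 + m13 * v1 + m23 * v2"
  define l1 where "l1 = d * v1 + (m12 * m33 - m13 * m23) * v2"
  have d: "0 < d" and e: "0 < e" using m2 det by (simp_all add: d_def e_def)
  have eq: "m33 * d * ?q = d * l3\<^sup>2 + l1\<^sup>2 + m33 * e * v2\<^sup>2"
    unfolding l1_def l3_def d_def e_def by algebra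
  have nn: "0 \<le> d * l3\<^sup>2" "0 \<le> l1\<^sup>2" "0 \<le> m33 * e * v2\<^sup>2" using d e m33 by simp_all
  have "0 < d * l3\<^sup>2 + l1\<^sup>2 + m33 * e * v2\<^sup>2"
  proof (cases "v2 = 0")
    case False
    then have "0 < m33 * e * v2\<^sup>2" using e m33 by simp
    then show ?thesis using nn by linarith
  next
    case v2: True
    show ?thesis
    proof (cases "v1 = 0")
      case False
      then have "0 < l1\<^sup>2" using d v2 by (simp add: l1_def)
      then show ?thesis using nn by linarith
    next
      case True
      then have "0 < d * l3\<^sup>2" using v v2 d m33 by (simp add: l3_def)
      then show ?thesis using nn by linarith
    qed
  qed
  then have "0 < (m33 * d) * ?q" using eq by simp
  then show ?thesis using m33 d by (meson mult_pos_pos zero_less_mult_pos)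
qed

text \<open>One weight may be negative. The determinant of the form on the plane \<open>v3 = 0\<close> is the second elementary
  symmetric polynomial of the weights, so that it is positive; the two positive weights exclude the
  negative definite case.\<close>

lemma weighted_differences_pos:
  fixes p12 p13 p23 :: real
  assumes e2: "0 < p12 * p13 + p12 * p23 + p13 * p23"
    and two: "0 < p13 \<and> 0 < p23 \<or> 0 < p12 \<and> 0 < p23 \<or> 0 < p12 \<and> 0 < p13"
    and v: "v1 \<noteq> v2 \<or> v2 \<noteq> v3"
  shows "0 < p12 * (v1 - v2)\<^sup>2 + p13 * (v1 - v3)\<^sup>2 + p23 * (v2 - v3)\<^sup>2"
proof -
  have main: "0 < p * (u - v)\<^sup>2 + q * (u - w)\<^sup>2 + r * (v - w)\<^sup>2"
    if e: "0 < p * q + p * r + q * r" and qr: "0 < q" "0 < r" and ne: "u \<noteq> v \<or> v \<noteq> w"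
    for p q r u v w :: real
  proof -
    have eq: "(q + r) * (p * (u - v)\<^sup>2 + q * (u - w)\<^sup>2 + r * (v - w)\<^sup>2)
      = (p * q + p * r + q * r) * (u - v)\<^sup>2 + (q * (u - w) + r * (v - w))\<^sup>2" by algebra
    have "0 < (p * q + p * r + q * r) * (u - v)\<^sup>2 + (q * (u - w) + r * (v - w))\<^sup>2"
    proof (cases "u = v")
      case True
      then have "q * (u - w) + r * (v - w) = (q + r) * (v - w)" by (simp add: algebra_simps)
      then have "0 < (q * (u - w) + r * (v - w))\<^sup>2" using True ne qr by simp
      then show ?thesis using True by simp
    next
      case False
      then have "0 < (p * q + p * r + q * r) * (u - v)\<^sup>2" using e by simp
      then show ?thesis by (simp add: add_pos_nonneg)
    qed
    then show ?thesis using qr unfolding eq[symmetric] by (simp add: zero_less_mult_iff)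
  qed
  from two show ?thesis
  proof (elim disjE)
    assume "0 < p13 \<and> 0 < p23"
    then show ?thesis using main[of p12 p13 p23 v1 v2 v3] e2 v by auto
  next
    assume "0 < p12 \<and> 0 < p23"
    then show ?thesis using main[of p13 p12 p23 v1 v3 v2] e2 v by (auto simp: mult_ac add_ac power2_commute)
  next
    assume "0 < p12 \<and> 0 < p13"
    then show ?thesis using main[of p23 p12 p13 v2 v3 v1] e2 v by (auto simp: mult_ac add_ac power2_commute)
  qed
qed

section \<open>The derivative of the angles of a hyperbolic triangle\<close>

text \<open>Here \<open>x, y, z\<close> are the hyperbolic cosines of the lengths of the edges \<open>12, 23, 13\<close>, and \<open>C\<^sub>i\<close> is the
  hyperbolic cosine of the radius at \<open>i\<close>. The lengths and the \<open>C\<^sub>i\<close> determine the inversive distances,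
  and in these variables the derivative \<open>C1 x - C2\<close> of \<open>x\<close> in the direction of the first coordinate is
  linear in the \<open>C\<^sub>i\<close>. The left-hand side is the derivative of \<open>- \<Sum>\<^sub>i v\<^sub>i \<theta>\<^sub>i\<close> in the direction \<open>v\<close>, multiplied
  by the square root of \<open>1 + 2 x y z - x\<^sup>2 - y\<^sup>2 - z\<^sup>2\<close>. The right-hand side shows that it is a
  quadratic form in \<open>v\<close> with symmetric matrix, assembled from positive definite forms of the edges.\<close>

lemma hyp_energy_identity:
  fixes C1 C2 C3 x y z :: real
  assumes gt1: "1 < x" "1 < y" "1 < z"
    and w12: "w12 * (x\<^sup>2 - 1) = C1 * (x * y - z) + C2 * (x * z - y) - C3 * (x\<^sup>2 - 1)"
    and w13: "w13 * (z\<^sup>2 - 1) = C1 * (y * z - x) + C3 * (x * z - y) - C2 * (z\<^sup>2 - 1)"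
    and w23: "w23 * (y\<^sup>2 - 1) = C2 * (y * z - x) + C3 * (x * y - z) - C1 * (y\<^sup>2 - 1)"
    and x': "x' = (C1 * x - C2) * v1 + (C2 * x - C1) * v2"
    and y': "y' = (C2 * y - C3) * v2 + (C3 * y - C2) * v3"
    and z': "z' = (C1 * z - C3) * v1 + (C3 * z - C1) * v3"
  defines "X \<equiv> x\<^sup>2 - 1" and "Y \<equiv> y\<^sup>2 - 1" and "Z \<equiv> z\<^sup>2 - 1"
  shows "v1 * ((x * y - z) * x' / X - y' + (y * z - x) * z' / Z)
      + v2 * ((x * z - y) * x' / X - z' + (y * z - x) * y' / Y)
      + v3 * ((x * z - y) * z' / Z - x' + (x * y - z) * y' / Y)
    = w12 * (x * (v1\<^sup>2 + v2\<^sup>2) - 2 * v1 * v2) + w13 * (z * (v1\<^sup>2 + v3\<^sup>2) - 2 * v1 * v3)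
      + w23 * (y * (v2\<^sup>2 + v3\<^sup>2) - 2 * v2 * v3)"
proof -
  have nz: "X \<noteq> 0" "Y \<noteq> 0" "Z \<noteq> 0"
    using gt1 by (auto simp: X_def Y_def Z_def power2_eq_1_iff)
  define iX iY iZ where "iX = 1 / X" and "iY = 1 / Y" and "iZ = 1 / Z"
  have i: "X * iX = 1" "Y * iY = 1" "Z * iZ = 1" using nz by (simp_all add: iX_def iY_def iZ_def)
  have "v1 * ((x * y - z) * x' * iX - y' + (y * z - x) * z' * iZ)
      + v2 * ((x * z - y) * x' * iX - z' + (y * z - x) * y' * iY)
      + v3 * ((x * z - y) * z' * iZ - x' + (x * y - z) * y' * iY)
    = w12 * (x * (v1\<^sup>2 + v2\<^sup>2) - 2 * v1 * v2) + w13 * (z * (v1\<^sup>2 + v3\<^sup>2) - 2 * v1 * v3)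
      + w23 * (y * (v2\<^sup>2 + v3\<^sup>2) - 2 * v2 * v3)"
    using i w12 w13 w23 unfolding x' y' z' X_def Y_def Z_def by algebra
  then show ?thesis by (simp add: iX_def iY_def iZ_def)
qed

text \<open>Up to a negative factor, the matrix of the form is the product of the derivative of the angles with respect to \<open>x, y, z\<close>
  and the derivative of \<open>x, y, z\<close> with respect to the coordinates, whose entries are the \<open>D\<close>s. So its
  determinant is a positive multiple of the determinant of the lengths. The Cauchy-Binet formula
  expresses the minor of the rows 1 and 3, and this minor is a positive combination of the determinant and
  the bracket whose sign is assumed.\<close>

lemma hyp_form_pos_by_minors:
  fixes C1 C2 C3 x y z :: real
  assumes C: "0 < C1" "0 < C2" "0 < C3"
    and x: "1 < x" and y: "1 < y" and z: "1 < z" and D: "0 < 1 + 2 * x * y * z - x\<^sup>2 - y\<^sup>2 - z\<^sup>2"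
  defines "n1 \<equiv> x * z - y" and "n2 \<equiv> x * y - z" and "n3 \<equiv> y * z - x"
    and "X \<equiv> x\<^sup>2 - 1" and "Y \<equiv> y\<^sup>2 - 1" and "Z \<equiv> z\<^sup>2 - 1"
  assumes w12: "w12 * X = C1 * n2 + C2 * n1 - C3 * X"
    and w13: "w13 * Z = C1 * n3 + C3 * n1 - C2 * Z"
    and w23: "w23 * Y = C2 * n3 + C3 * n2 - C1 * Y"
  defines "D12 \<equiv> C1 * x - C2" and "D21 \<equiv> C2 * x - C1" and "D23 \<equiv> C2 * y - C3" and "D32 \<equiv> C3 * y - C2"
    and "D13 \<equiv> C1 * z - C3" and "D31 \<equiv> C3 * z - C1"
  assumes dd: "0 < D12 * D23 * D31 + D21 * D32 * D13"
    and w: "0 < w13" "0 < w23"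
    and minor: "0 \<le> D12 * (n2 * D13 * D32 + Y * D31 * D12)"
    and v: "v1 \<noteq> 0 \<or> v2 \<noteq> 0 \<or> v3 \<noteq> 0"
  shows "0 < w12 * (x * (v1\<^sup>2 + v2\<^sup>2) - 2 * v1 * v2) + w13 * (z * (v1\<^sup>2 + v3\<^sup>2) - 2 * v1 * v3)
      + w23 * (y * (v2\<^sup>2 + v3\<^sup>2) - 2 * v2 * v3)"
proof -
  have pos: "0 < X" "0 < Y" "0 < Z" using x y z by (simp_all add: X_def Y_def Z_def)
  define \<Delta> where "\<Delta> = 1 + 2 * x * y * z - x\<^sup>2 - y\<^sup>2 - z\<^sup>2"
  define iX iY iZ where "iX = 1 / X" and "iY = 1 / Y" and "iZ = 1 / Z"
  have i: "X * iX = 1" "Y * iY = 1" "Z * iZ = 1" using pos by (simp_all add: iX_def iY_def iZ_def)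
  have w_eq: "w12 = (C1 * n2 + C2 * n1 - C3 * X) * iX" "w13 = (C1 * n3 + C3 * n1 - C2 * Z) * iZ"
    "w23 = (C2 * n3 + C3 * n2 - C1 * Y) * iY"
    using i w12 w13 w23 by algebra+
  have m11: "w12 * x + w13 * z = n2 * iX * D12 + n3 * iZ * D13"
    using i unfolding w_eq D12_def D13_def n1_def n2_def n3_def X_def Y_def Z_def by algebra
  have m22: "w12 * x + w23 * y = n1 * iX * D21 + n3 * iY * D23"
    using i unfolding w_eq D21_def D23_def n1_def n2_def n3_def X_def Y_def Z_def by algebra
  have m33: "w13 * z + w23 * y = n1 * iZ * D31 + n2 * iY * D32"
    using i unfolding w_eq D31_def D32_def n1_def n2_def n3_def X_def Y_def Z_def by algebra
  have m12: "- w12 = n2 * iX * D21 - D23" "- w12 = n1 * iX * D12 - D13"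
    using i unfolding w_eq D21_def D23_def D12_def D13_def n1_def n2_def n3_def X_def Y_def Z_def by algebra+
  have m13: "- w13 = n3 * iZ * D31 - D32" "- w13 = n1 * iZ * D13 - D12"
    using i unfolding w_eq D31_def D32_def D12_def D13_def n1_def n2_def n3_def X_def Y_def Z_def by algebra+
  have m23: "- w23 = n3 * iY * D32 - D31" "- w23 = n2 * iY * D23 - D21"
    using i unfolding w_eq D31_def D32_def D21_def D23_def n1_def n2_def n3_def X_def Y_def Z_def by algebra+
  \<comment> \<open>The factor in parentheses is the minor of the rows 1 and 3, up to a positive factor.\<close>
  have c1: "C1 * (X * y * D32 * D13 - Z * D32 * D12 + Y * x * D31 * D12)
     = y * (D12 * D23 * D31 + D21 * D32 * D13) + D12 * (n2 * D13 * D32 + Y * D31 * D12)"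
    unfolding D31_def D32_def D21_def D23_def D12_def D13_def n2_def X_def Y_def Z_def by algebra
  have "0 < C1 * (X * y * D32 * D13 - Z * D32 * D12 + Y * x * D31 * D12)"
    unfolding c1 by (rule add_pos_nonneg[OF mult_pos_pos[OF _ dd] minor]) (use y in simp)
  then have N: "0 < X * y * D32 * D13 - Z * D32 * D12 + Y * x * D31 * D12"
    using C(1) by (rule zero_less_mult_pos)
  define p q r s t u where "p = n2 * iX" and "q = n3 * iZ" and "r = n1 * iZ" and "s = n2 * iY"
    and "t = n1 * iX" and "u = n3 * iY"
  have entries: "X * p = n2" "Z * q = n3" "Z * r = n1" "Y * s = n2" "X * t = n1" "Y * u = n3"
    unfolding p_def q_def r_def s_def t_def u_def using i by algebra+
  have XY: "X * Y = n2\<^sup>2 + \<Delta>" and XZ: "X * Z = n1\<^sup>2 + \<Delta>" and YZ: "Y * Z = n3\<^sup>2 + \<Delta>"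
    and nX: "n1 * n2 + n3 * X = x * \<Delta>" and nY: "n2 * n3 + n1 * Y = y * \<Delta>"
    and det0: "2 * (n1 * n2 * n3) + n2\<^sup>2 * Z + n1\<^sup>2 * Y + n3\<^sup>2 * X - X * Y * Z = \<Delta>\<^sup>2"
    unfolding n1_def n2_def n3_def X_def Y_def Z_def \<Delta>_def by algebra+
  note m11 = m11[folded p_def q_def] and m22 = m22[folded t_def u_def] and m33 = m33[folded r_def s_def]
    and m12 = m12[folded p_def t_def] and m13 = m13[folded q_def r_def] and m23 = m23[folded u_def s_def]
  have "(w12 * x + w13 * z) * (w13 * z + w23 * y) - (- w13)\<^sup>2
      = (p * D12 + q * D13) * (r * D31 + s * D32) - (q * D31 - D32) * (r * D13 - D12)"
    unfolding power2_eq_square m11 m33 by (simp only: m13[symmetric])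
  also have "\<dots> = (p * s - 1) * D12 * D32 + (p * r + q) * D12 * D31 + (r + q * s) * D32 * D13"
    by algebra
  finally have "X * Y * Z * ((w12 * x + w13 * z) * (w13 * z + w23 * y) - (- w13)\<^sup>2)
      = \<Delta> * (X * y * D32 * D13 - Z * D32 * D12 + Y * x * D31 * D12)"
    using entries XY nX nY by algebra
  moreover have "0 < \<Delta> * (X * y * D32 * D13 - Z * D32 * D12 + Y * x * D31 * D12)"
    using D N by (simp add: \<Delta>_def)
  ultimately have minor_pos: "0 < (w12 * x + w13 * z) * (w13 * z + w23 * y) - (- w13)\<^sup>2"
    using pos by (metis mult_pos_pos zero_less_mult_pos)
  have "(w12 * x + w13 * z) * ((w12 * x + w23 * y) * (w13 * z + w23 * y) - (- w23)\<^sup>2)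
      - (- w12) * ((- w12) * (w13 * z + w23 * y) - (- w23) * (- w13))
      + (- w13) * ((- w12) * (- w23) - (w12 * x + w23 * y) * (- w13))
    = (p * D12 + q * D13) * ((t * D21 + u * D23) * (r * D31 + s * D32) - (u * D32 - D31) * (s * D23 - D21))
      - (p * D21 - D23) * ((t * D12 - D13) * (r * D31 + s * D32) - (u * D32 - D31) * (r * D13 - D12))
      + (q * D31 - D32) * ((t * D12 - D13) * (s * D23 - D21) - (t * D21 + u * D23) * (r * D13 - D12))"
    unfolding power2_eq_square m11 m22 m33
    by (simp only: m12[symmetric] m13[symmetric] m23[symmetric])
  also have "\<dots> = (2 * (p * r * u) + p * s + r * t + q * u - 1 + (q * s * t - p * r * u)) * (D12 * D23 * D31 + D21 * D32 * D13)"
    by algebra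
  finally have "X * Y * Z * ((w12 * x + w13 * z) * ((w12 * x + w23 * y) * (w13 * z + w23 * y) - (- w23)\<^sup>2)
      - (- w12) * ((- w12) * (w13 * z + w23 * y) - (- w23) * (- w13))
      + (- w13) * ((- w12) * (- w23) - (w12 * x + w23 * y) * (- w13)))
    = \<Delta>\<^sup>2 * (D12 * D23 * D31 + D21 * D32 * D13)"
    using entries det0 by algebra
  moreover have "0 < \<Delta>\<^sup>2 * (D12 * D23 * D31 + D21 * D32 * D13)"
    using D dd by (intro mult_pos_pos) (auto simp: \<Delta>_def)
  ultimately have det_pos: "0 < (w12 * x + w13 * z) * ((w12 * x + w23 * y) * (w13 * z + w23 * y) - (- w23)\<^sup>2)
      - (- w12) * ((- w12) * (w13 * z + w23 * y) - (- w23) * (- w13))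
      + (- w13) * ((- w12) * (- w23) - (w12 * x + w23 * y) * (- w13))"
    using pos by (metis mult_pos_pos zero_less_mult_pos)
  have "0 < w13 * z + w23 * y" using w y z by (intro add_pos_pos mult_pos_pos) auto
  from positive_definite_3[OF this minor_pos det_pos v] show ?thesis
    by (simp add: algebra_simps)
qed

context inversive_triple begin

text \<open>If the edge \<open>23\<close> gets shorter when the radius at 3 grows, the bracket in the minor of the rows 1 and 3 can
  only be negative for an acute angle at 2. In this case \<open>b < 0\<close> and \<open>c > - b\<close>, and two comparisons compensate
  for the negative term. The edge \<open>13\<close> grows with the radius at 3 at least as fast as the edge \<open>23\<close> shrinks
  (\<open>st\<close> below), and the edge \<open>12\<close> grows with the radius at 1 at least as fast as the edge \<open>13\<close> because the
  weight of the edge \<open>12\<close> is negative (\<open>d\<close> below).\<close>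

lemma bracket_nonneg_of_shrinking_edge:
  fixes C1 C2 C3 S1 S2 S3 :: real
  assumes C: "0 < C1" "0 < C2" "0 < C3" and S: "0 < S1" "0 < S2" "0 < S3"
    and CS: "C1\<^sup>2 = S1\<^sup>2 + 1" "C2\<^sup>2 = S2\<^sup>2 + 1" "C3\<^sup>2 = S3\<^sup>2 + 1"
    and x_def: "x = C1 * C2 + a * S1 * S2" and y_def: "y = C2 * C3 + b * S2 * S3"
    and z_def: "z = C1 * C3 + c * S1 * S3"
    and gt1: "1 < x" "1 < y" "1 < z" and D: "0 < 1 + 2 * x * y * z - x\<^sup>2 - y\<^sup>2 - z\<^sup>2"
    and a: "1 < a"
    and H3: "C1 * (x * y - z) + C2 * (x * z - y) - C3 * (x\<^sup>2 - 1) < 0"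
    and D32: "C3 * y - C2 < 0"
  shows "0 \<le> (C1 * x - C2) * ((x * y - z) * (C1 * z - C3) * (C3 * y - C2) + (y\<^sup>2 - 1) * (C3 * z - C1) * (C1 * x - C2))"
proof -
  define X Y Z where "X = x\<^sup>2 - 1" and "Y = y\<^sup>2 - 1" and "Z = z\<^sup>2 - 1"
  have pos: "0 < X" "0 < Y" "0 < Z" using gt1 by (simp_all add: X_def Y_def Z_def)
  define D12 D13 D31 where "D12 = C1 * x - C2" and "D13 = C1 * z - C3" and "D31 = C3 * z - C1"
  define n1 n2 where "n1 = x * z - y" and "n2 = x * y - z"
  define s where "s = - (C2 * S3 + b * C3 * S2)"
  define t where "t = C1 * S3 + c * C3 * S1"
  have D32_eq: "C3 * y - C2 = - (S3 * s)" unfolding y_def s_def using CS by algebra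
  have s: "0 < s" using D32 S unfolding D32_eq by (simp add: zero_less_mult_iff)
  have b: "b < 0"
  proof (rule ccontr)
    assume "\<not> b < 0"
    then have "0 \<le> b * C3 * S2" "0 < C2 * S3" using C S by simp_all
    with s show False by (simp add: s_def)
  qed
  have c: "- b < c"
  proof -
    have "- b * 1 < - b * a" using a b by (intro mult_strict_left_mono) auto
    then show ?thesis using struct(2) by (simp add: mult.commute)
  qed
  then have c0: "0 < c" using b by linarith
  have t: "0 < t" using C S c0 by (simp add: t_def add_pos_pos)
  have D12_eq: "D12 = S1 * (C2 * S1 + a * C1 * S2)" unfolding D12_def x_def using CS by algebra
  have D13_eq: "D13 = S1 * (C3 * S1 + c * C1 * S3)" unfolding D13_def z_def using CS by algebra
  have D31_eq: "D31 = S3 * t" unfolding D31_def z_def t_def using CS by algebra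
  have D12: "0 < D12" and D13: "0 < D13" and D31: "0 < D31"
    unfolding D12_eq D13_eq D31_eq using C S a c0 t by (simp_all add: add_pos_pos)
  have Y_eq: "Y = s\<^sup>2 + S2\<^sup>2 * (1 - b\<^sup>2)" unfolding Y_def y_def s_def using CS by algebra
  have Z_eq: "Z = t\<^sup>2 + S1\<^sup>2 * (1 - c\<^sup>2)" unfolding Z_def z_def t_def using CS by algebra
  have "(s * S1)\<^sup>2 * (1 - c\<^sup>2) \<le> (t * S2)\<^sup>2 * (1 - b\<^sup>2)"
  proof -
    have b2: "0 < 1 - b\<^sup>2" using b gt abs_square_less_1[of b] by simp
    have "b\<^sup>2 < c\<^sup>2" using power_strict_mono[of "- b" c 2] b c by simp
    have "t * S2 - s * S1 = S2 * S3 * C1 + C2 * S1 * S3 + (c + b) * (C3 * S1 * S2)"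
      by (simp add: t_def s_def algebra_simps)
    also have "\<dots> > 0" using C S c by (simp add: add_pos_pos)
    finally have "(s * S1)\<^sup>2 \<le> (t * S2)\<^sup>2" using s S by (intro power_mono) auto
    have "(s * S1)\<^sup>2 * (1 - c\<^sup>2) \<le> (s * S1)\<^sup>2 * (1 - b\<^sup>2)"
      using \<open>b\<^sup>2 < c\<^sup>2\<close> by (intro mult_left_mono) auto
    also have "\<dots> \<le> (t * S2)\<^sup>2 * (1 - b\<^sup>2)"
      using \<open>(s * S1)\<^sup>2 \<le> (t * S2)\<^sup>2\<close> b2 by (intro mult_right_mono) auto
    finally show ?thesis .
  qed
  then have st: "s\<^sup>2 * Z \<le> t\<^sup>2 * Y" unfolding Y_eq Z_eq by (simp add: algebra_simps)
  have "n1\<^sup>2 \<le> X * Z" and n2: "n2\<^sup>2 \<le> X * Y"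
    using D unfolding n1_def n2_def X_def Y_def Z_def by (simp_all add: power2_eq_square algebra_simps)
  have "D13 * X < n1 * D12" using H3 unfolding D13_def X_def n1_def D12_def by (simp add: algebra_simps power2_eq_square)
  then have "(D13 * X)\<^sup>2 \<le> (n1 * D12)\<^sup>2" using D13 pos by (intro power_mono) auto
  also have "\<dots> \<le> X * Z * D12\<^sup>2" using \<open>n1\<^sup>2 \<le> X * Z\<close> by (simp add: power_mult_distrib mult_right_mono)
  finally have "X * (D13\<^sup>2 * X) \<le> X * (Z * D12\<^sup>2)" by (simp add: power2_eq_square mult_ac)
  then have d: "D13\<^sup>2 * X \<le> Z * D12\<^sup>2" using pos by simp
  \<comment> \<open>If \<open>n2 > 0\<close>, then \<open>n2 / sqrt (X * Y)\<close> is the cosine of the angle at 2, which is at most 1.\<close>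
  have "n2 * D13 * s \<le> Y * t * D12"
  proof (rule power2_le_imp_le)
    have "(n2 * D13 * s)\<^sup>2 = n2\<^sup>2 * (D13\<^sup>2 * s\<^sup>2)" by (simp add: power_mult_distrib mult_ac)
    also have "\<dots> \<le> X * Y * (D13\<^sup>2 * s\<^sup>2)" using n2 by (intro mult_right_mono) auto
    also have "\<dots> = Y * s\<^sup>2 * (D13\<^sup>2 * X)" by simp
    also have "\<dots> \<le> Y * s\<^sup>2 * (Z * D12\<^sup>2)" using d pos by (intro mult_left_mono) auto
    also have "\<dots> = Y * D12\<^sup>2 * (s\<^sup>2 * Z)" by simp
    also have "\<dots> \<le> Y * D12\<^sup>2 * (t\<^sup>2 * Y)" using st pos by (intro mult_left_mono) auto
    also have "\<dots> = (Y * t * D12)\<^sup>2" by (simp add: power2_eq_square mult_ac)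
    finally show "(n2 * D13 * s)\<^sup>2 \<le> (Y * t * D12)\<^sup>2" .
  qed (use pos t D12 in simp)
  then have "0 \<le> S3 * (Y * t * D12 - n2 * D13 * s)" using S by simp
  also have "\<dots> = n2 * D13 * - (S3 * s) + Y * D31 * D12" unfolding D31_eq by (simp add: algebra_simps)
  finally have "0 \<le> D12 * (n2 * D13 * (C3 * y - C2) + Y * D31 * D12)"
    using D12 unfolding D32_eq by simp
  then show ?thesis unfolding D12_def D13_def D31_def Y_def n2_def .
qed

text \<open>A negative weight of the edge \<open>12\<close> prevents the edge \<open>23\<close> from shrinking when the radius at 2 grows:
  otherwise the assumption on the height would contradict \<open>c + a * b \<ge> 0\<close>.\<close>

lemma edge_derivative_nonneg:
  assumes k: "0 < k1" "0 < k2" "0 < k3" and a: "1 < a"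
    and h3: "k3 * (1 - a\<^sup>2) + k1 * (c + a * b) + k2 * (b + a * c) < 0"
  shows "0 \<le> k3 + b * k2"
proof (rule ccontr)
  assume "\<not> 0 \<le> k3 + b * k2"
  then have n: "k3 < - b * k2" by simp
  have "1 < a\<^sup>2" using a by simp
  have "k2 * (b + a * c) \<le> k1 * (c + a * b) + k2 * (b + a * c)" using k struct by simp
  also have "\<dots> < k3 * (a\<^sup>2 - 1)" using h3 by (simp add: algebra_simps)
  also have "\<dots> \<le> - b * k2 * (a\<^sup>2 - 1)" using n \<open>1 < a\<^sup>2\<close> by (intro mult_right_mono) auto
  finally have "k2 * (b + a * c) < k2 * (b - a * (a * b))" by (simp add: algebra_simps power2_eq_square)
  then have "b + a * c < b - a * (a * b)" using k by simp
  then have "a * (c + a * b) < 0" by (simp add: algebra_simps)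
  then show False using a struct(2) by (simp add: mult_less_0_iff)
qed

text \<open>The only interesting case is that of a negative weight \<open>w12\<close>. The minors of the rows 1, 3 and of
  the rows 2, 3 contain the brackets \<open>?A\<close> and \<open>?B\<close>. When no edge shrinks under a growing radius, each bracket is nonnegative as
  soon as the angle at 2 or at 1, respectively, is not obtuse, and a triangle has at most one obtuse
  angle. When the edge \<open>23\<close> or \<open>13\<close> shrinks with growing third radius,
  \<open>bracket_nonneg_of_shrinking_edge\<close> applies.\<close>

lemma hyp_form_pos_of_two_weights:
  fixes C1 C2 C3 S1 S2 S3 :: real
  assumes C: "0 < C1" "0 < C2" "0 < C3" and S: "0 < S1" "0 < S2" "0 < S3"
    and CS: "C1\<^sup>2 = S1\<^sup>2 + 1" "C2\<^sup>2 = S2\<^sup>2 + 1" "C3\<^sup>2 = S3\<^sup>2 + 1"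
    and x_def: "x = C1 * C2 + a * S1 * S2" and y_def: "y = C2 * C3 + b * S2 * S3"
    and z_def: "z = C1 * C3 + c * S1 * S3"
    and gt1: "1 < x" "1 < y" "1 < z" and D: "0 < 1 + 2 * x * y * z - x\<^sup>2 - y\<^sup>2 - z\<^sup>2"
    and w12: "w12 * (x\<^sup>2 - 1) = C1 * (x * y - z) + C2 * (x * z - y) - C3 * (x\<^sup>2 - 1)"
    and w13: "w13 * (z\<^sup>2 - 1) = C1 * (y * z - x) + C3 * (x * z - y) - C2 * (z\<^sup>2 - 1)"
    and w23: "w23 * (y\<^sup>2 - 1) = C2 * (y * z - x) + C3 * (x * y - z) - C1 * (y\<^sup>2 - 1)"
    and w: "0 < w13" "0 < w23" and v: "v1 \<noteq> 0 \<or> v2 \<noteq> 0 \<or> v3 \<noteq> 0"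
  shows "0 < w12 * (x * (v1\<^sup>2 + v2\<^sup>2) - 2 * v1 * v2) + w13 * (z * (v1\<^sup>2 + v3\<^sup>2) - 2 * v1 * v3)
      + w23 * (y * (v2\<^sup>2 + v3\<^sup>2) - 2 * v2 * v3)"
proof (cases "0 \<le> w12")
  case True
  have nn: "0 \<le> t * (u\<^sup>2 + v\<^sup>2) - 2 * u * v" and p: "u \<noteq> 0 \<or> v \<noteq> 0 \<Longrightarrow> 0 < t * (u\<^sup>2 + v\<^sup>2) - 2 * u * v"
    if t: "1 < t" for t u v :: real
  proof -
    have eq: "t * (u\<^sup>2 + v\<^sup>2) - 2 * u * v = (t - 1) * (u\<^sup>2 + v\<^sup>2) + (u - v)\<^sup>2" by algebra
    show "0 \<le> t * (u\<^sup>2 + v\<^sup>2) - 2 * u * v" unfolding eq using t by simp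
    show "0 < t * (u\<^sup>2 + v\<^sup>2) - 2 * u * v" if "u \<noteq> 0 \<or> v \<noteq> 0"
    proof -
      have "0 < (t - 1) * (u\<^sup>2 + v\<^sup>2)" using t that by (simp add: sum_power2_gt_zero_iff)
      then show ?thesis unfolding eq by (simp add: add_pos_nonneg)
    qed
  qed
  have "0 \<le> w12 * (x * (v1\<^sup>2 + v2\<^sup>2) - 2 * v1 * v2)" using True nn[OF gt1(1), of v1 v2] by simp
  moreover have "0 \<le> w13 * (z * (v1\<^sup>2 + v3\<^sup>2) - 2 * v1 * v3)" using w nn[OF gt1(3), of v1 v3] by simp
  moreover have "0 \<le> w23 * (y * (v2\<^sup>2 + v3\<^sup>2) - 2 * v2 * v3)" using w nn[OF gt1(2), of v2 v3] by simp
  moreover have "0 < w13 * (z * (v1\<^sup>2 + v3\<^sup>2) - 2 * v1 * v3) \<or> 0 < w23 * (y * (v2\<^sup>2 + v3\<^sup>2) - 2 * v2 * v3)"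
    using v p[OF gt1(3), of v1 v3] p[OF gt1(2), of v2 v3] w by (metis mult_pos_pos)
  ultimately show ?thesis by linarith
next
  case False
  define k1 k2 k3 where "k1 = C1 * S2 * S3" and "k2 = C2 * S1 * S3" and "k3 = C3 * S1 * S2"
  have k: "0 < k1" "0 < k2" "0 < k3" using C S by (simp_all add: k1_def k2_def k3_def)
  have "w12 * (x\<^sup>2 - 1) < 0" using False gt1 by (simp add: mult_less_0_iff)
  then have H3: "C1 * (x * y - z) + C2 * (x * z - y) - C3 * (x\<^sup>2 - 1) < 0" using w12 by simp
  have "C1 * (x * y - z) + C2 * (x * z - y) - C3 * (x\<^sup>2 - 1)
      = S1 * S2 * (k3 * (1 - a\<^sup>2) + k1 * (c + a * b) + k2 * (b + a * c))"
    unfolding x_def y_def z_def k1_def k2_def k3_def using CS by algebra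
  then have h3: "k3 * (1 - a\<^sup>2) + k1 * (c + a * b) + k2 * (b + a * c) < 0"
    using H3 S by (simp add: mult_less_0_iff)
  have "0 \<le> k1 * (c + a * b)" "0 \<le> k2 * (b + a * c)" using k struct by simp_all
  then have "k3 * (1 - a\<^sup>2) < 0" using h3 by linarith
  then have "1 < a\<^sup>2" using k by (simp add: mult_less_0_iff)
  then have a: "1 < a" using gt abs_square_le_1[of a] by linarith
  have e: "C1 * x - C2 = S1 * (C2 * S1 + a * C1 * S2)" "C2 * x - C1 = S2 * (C1 * S2 + a * C2 * S1)"
    "C2 * y - C3 = S2 * (C3 * S2 + b * C2 * S3)" "C3 * y - C2 = S3 * (C2 * S3 + b * C3 * S2)"
    "C1 * z - C3 = S1 * (C3 * S1 + c * C1 * S3)" "C3 * z - C1 = S3 * (C1 * S3 + c * C3 * S1)"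
    unfolding x_def y_def z_def using CS by algebra+
  have "(C1 * x - C2) * (C2 * y - C3) * (C3 * z - C1) + (C2 * x - C1) * (C3 * y - C2) * (C1 * z - C3)
      = (k2 + a * k1) * (k3 + b * k2) * (k1 + c * k3) + (k1 + a * k2) * (k2 + b * k3) * (k3 + c * k1)"
    unfolding e k1_def k2_def k3_def by algebra
  then have dd: "0 < (C1 * x - C2) * (C2 * y - C3) * (C3 * z - C1) + (C2 * x - C1) * (C3 * y - C2) * (C1 * z - C3)"
    using length_jacobian_pos[OF k] by simp
  interpret swap: inversive_triple a c b by (rule inversive_triple_swap12) unfold_locales
  have D12: "0 < C1 * x - C2" "0 < C2 * x - C1"
    unfolding e using a C S by (simp_all add: add_pos_pos)
  have "0 \<le> S1 * (k3 + b * k2)" using edge_derivative_nonneg[OF k a h3] S by simp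
  also have "\<dots> = S1\<^sup>2 * (C3 * S2 + b * C2 * S3)" by (simp add: k2_def k3_def algebra_simps power2_eq_square)
  finally have D23: "0 \<le> C2 * y - C3" unfolding e using S by (simp add: zero_le_mult_iff)
  have "0 \<le> S2 * (k3 + c * k1)"
    using swap.edge_derivative_nonneg[OF k(2) k(1) k(3) a] h3 S by (simp add: add_ac mult_ac)
  also have "\<dots> = S2\<^sup>2 * (C3 * S1 + c * C1 * S3)" by (simp add: k1_def k3_def algebra_simps power2_eq_square)
  finally have D13: "0 \<le> C1 * z - C3" unfolding e using S by (simp add: zero_le_mult_iff)
  have "0 \<le> (C1 * x - C2) * ((x * y - z) * (C1 * z - C3) * (C3 * y - C2) + (y\<^sup>2 - 1) * (C3 * z - C1) * (C1 * x - C2))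
    \<or> 0 \<le> (C2 * x - C1) * ((x * z - y) * (C2 * y - C3) * (C3 * z - C1) + (z\<^sup>2 - 1) * (C3 * y - C2) * (C2 * x - C1))"
    (is "?A \<or> ?B")
  proof -
    \<comment> \<open>These quantities are the derivatives of \<open>y\<close> and \<open>z\<close> with respect to the third coordinate.\<close>
    consider "C3 * y - C2 < 0" | "C3 * z - C1 < 0" | "0 \<le> C3 * y - C2" "0 \<le> C3 * z - C1" by linarith
    then show ?thesis
    proof cases
      case 1
      then show ?thesis using bracket_nonneg_of_shrinking_edge[OF C S CS x_def y_def z_def gt1 D a H3] by simp
    next
      case 2
      then have ?B
      proof (intro swap.bracket_nonneg_of_shrinking_edge[OF C(2) C(1) C(3) S(2) S(1) S(3) CS(2) CS(1) CS(3)])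
        show "x = C2 * C1 + a * S2 * S1" using x_def by simp
        show "0 < 1 + 2 * x * z * y - x\<^sup>2 - z\<^sup>2 - y\<^sup>2" using D by (simp add: mult_ac)
        show "C2 * (x * z - y) + C1 * (x * y - z) - C3 * (x\<^sup>2 - 1) < 0" using H3 by simp
      qed (rule y_def z_def gt1 a 2 | assumption)+
      then show ?thesis ..
    next
      case 3
      have "0 \<le> x * y - z \<or> 0 \<le> x * z - y"
      proof (rule ccontr)
        assume "\<not> ?thesis"
        then have "x * y < z" "x * z < y" by auto
        then have "x * (x * y) < x * z" using gt1 by simp
        then have "(x * x) * y < 1 * y" using \<open>x * z < y\<close> by simp
        then have "x * x < 1" using gt1 by (simp add: mult_less_cancel_right)
        then show False using gt1 by (smt (verit) mult_le_cancel_left1)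
      qed
      then show ?thesis
        using 3 D12 D13 D23 gt1
        by (elim disjE) (intro disjI1 disjI2 mult_nonneg_nonneg add_nonneg_nonneg; simp)+
    qed
  qed
  then show ?thesis
  proof
    assume ?A
    from hyp_form_pos_by_minors[OF C gt1 D w12 w13 w23 dd w this v] show ?thesis .
  next
    assume ?B
    have "0 < w12 * (x * (v2\<^sup>2 + v1\<^sup>2) - 2 * v2 * v1) + w23 * (y * (v2\<^sup>2 + v3\<^sup>2) - 2 * v2 * v3)
      + w13 * (z * (v1\<^sup>2 + v3\<^sup>2) - 2 * v1 * v3)"
    proof (rule hyp_form_pos_by_minors[where ?C1.0 = C2 and ?C2.0 = C1 and ?C3.0 = C3])
      show "0 < (C2 * x - C1) * (C1 * z - C3) * (C3 * y - C2) + (C1 * x - C2) * (C3 * z - C1) * (C2 * y - C3)"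
        using dd by (simp add: mult_ac add_ac)
      show "0 < 1 + 2 * x * z * y - x\<^sup>2 - z\<^sup>2 - y\<^sup>2" using D by (simp add: mult_ac)
      show "w12 * (x\<^sup>2 - 1) = C2 * (x * z - y) + C1 * (x * y - z) - C3 * (x\<^sup>2 - 1)" using w12 by simp
      show "w23 * (y\<^sup>2 - 1) = C2 * (z * y - x) + C3 * (x * y - z) - C1 * (y\<^sup>2 - 1)"
        using w23 by (simp add: mult.commute)
      show "w13 * (z\<^sup>2 - 1) = C1 * (z * y - x) + C3 * (x * z - y) - C2 * (z\<^sup>2 - 1)"
        using w13 by (simp add: mult.commute)
      show "v2 \<noteq> 0 \<or> v1 \<noteq> 0 \<or> v3 \<noteq> 0" using v by blast
    qed (rule C gt1 w \<open>?B\<close>)+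
    then show ?thesis by (simp add: algebra_simps)
  qed
qed

end

context inversive_triple begin

text \<open>The expression is a positive multiple of the derivative of \<open>- \<Sum>\<^sub>i v\<^sub>i \<theta>\<^sub>i\<close> in the direction \<open>v\<close>. The weights of the edges
  have the signs of the heights, so at least two of them are positive, and relabelling the vertices
  reduces the claim to \<open>hyp_form_pos_of_two_weights\<close>.\<close>

lemma hyp_angle_form_pos:
  fixes C1 C2 C3 S1 S2 S3 :: real
  assumes C: "0 < C1" "0 < C2" "0 < C3" and S: "0 < S1" "0 < S2" "0 < S3"
    and CS: "C1\<^sup>2 = S1\<^sup>2 + 1" "C2\<^sup>2 = S2\<^sup>2 + 1" "C3\<^sup>2 = S3\<^sup>2 + 1"
    and x_def: "x = C1 * C2 + a * S1 * S2" and y_def: "y = C2 * C3 + b * S2 * S3"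
    and z_def: "z = C1 * C3 + c * S1 * S3"
    and gt1: "1 < x" "1 < y" "1 < z" and D: "0 < 1 + 2 * x * y * z - x\<^sup>2 - y\<^sup>2 - z\<^sup>2"
    and x': "x' = (C1 * x - C2) * v1 + (C2 * x - C1) * v2"
    and y': "y' = (C2 * y - C3) * v2 + (C3 * y - C2) * v3"
    and z': "z' = (C1 * z - C3) * v1 + (C3 * z - C1) * v3"
    and v: "v1 \<noteq> 0 \<or> v2 \<noteq> 0 \<or> v3 \<noteq> 0"
  defines "X \<equiv> x\<^sup>2 - 1" and "Y \<equiv> y\<^sup>2 - 1" and "Z \<equiv> z\<^sup>2 - 1"
  shows "0 < v1 * ((x * y - z) * x' / X - y' + (y * z - x) * z' / Z)
      + v2 * ((x * z - y) * x' / X - z' + (y * z - x) * y' / Y)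
      + v3 * ((x * z - y) * z' / Z - x' + (x * y - z) * y' / Y)"
proof -
  have pos: "0 < X" "0 < Y" "0 < Z" using gt1 by (simp_all add: X_def Y_def Z_def)
  define w12 where "w12 = (C1 * (x * y - z) + C2 * (x * z - y) - C3 * (x\<^sup>2 - 1)) / X"
  define w13 where "w13 = (C1 * (y * z - x) + C3 * (x * z - y) - C2 * (z\<^sup>2 - 1)) / Z"
  define w23 where "w23 = (C2 * (y * z - x) + C3 * (x * y - z) - C1 * (y\<^sup>2 - 1)) / Y"
  have w_eq: "w12 * (x\<^sup>2 - 1) = C1 * (x * y - z) + C2 * (x * z - y) - C3 * (x\<^sup>2 - 1)"
    "w13 * (z\<^sup>2 - 1) = C1 * (y * z - x) + C3 * (x * z - y) - C2 * (z\<^sup>2 - 1)"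
    "w23 * (y\<^sup>2 - 1) = C2 * (y * z - x) + C3 * (x * y - z) - C1 * (y\<^sup>2 - 1)"
    using pos by (simp_all add: w12_def w13_def w23_def X_def Y_def Z_def)
  define k1 k2 k3 where "k1 = C1 * S2 * S3" and "k2 = C2 * S1 * S3" and "k3 = C3 * S1 * S2"
  have k: "0 < k1" "0 < k2" "0 < k3" using C S by (simp_all add: k1_def k2_def k3_def)
  define h1 h2 h3 where "h1 = k1 * (1 - b\<^sup>2) + k2 * (a + b * c) + k3 * (c + a * b)"
    and "h2 = k2 * (1 - c\<^sup>2) + k1 * (a + b * c) + k3 * (b + a * c)"
    and "h3 = k3 * (1 - a\<^sup>2) + k1 * (c + a * b) + k2 * (b + a * c)"
  have "w12 * X = S1 * S2 * h3" "w13 * Z = S1 * S3 * h2" "w23 * Y = S2 * S3 * h1"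
    using CS unfolding X_def Y_def Z_def w_eq
    unfolding x_def y_def z_def h1_def h2_def h3_def k1_def k2_def k3_def by algebra+
  then have sgn: "0 < w12 \<longleftrightarrow> 0 < h3" "0 < w13 \<longleftrightarrow> 0 < h2" "0 < w23 \<longleftrightarrow> 0 < h1"
    using pos S by (metis mult_pos_pos zero_less_mult_pos zero_less_mult_pos2)+
  interpret s13: inversive_triple b a c by (rule inversive_triple_swap13) unfold_locales
  interpret s23: inversive_triple c b a by (rule inversive_triple_swap23) unfold_locales
  have swapped: "x = C2 * C1 + a * S2 * S1" "y = C3 * C2 + b * S3 * S2" "z = C3 * C1 + c * S3 * S1"
    using x_def y_def z_def by simp_all
  have "\<not> (h1 \<le> 0 \<and> h2 \<le> 0)"
    using at_most_one_nonpos_height[OF k] by (auto simp: h1_def h2_def)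
  moreover have "\<not> (h1 \<le> 0 \<and> h3 \<le> 0)"
    using s23.at_most_one_nonpos_height[OF k(1) k(3) k(2)] by (auto simp: h1_def h3_def add_ac mult_ac)
  moreover have "\<not> (h3 \<le> 0 \<and> h2 \<le> 0)"
    using s13.at_most_one_nonpos_height[OF k(3) k(2) k(1)] by (auto simp: h2_def h3_def add_ac mult_ac)
  ultimately consider "0 < h1" "0 < h2" | "0 < h1" "0 < h3" | "0 < h2" "0 < h3" by linarith
  then have "0 < w12 * (x * (v1\<^sup>2 + v2\<^sup>2) - 2 * v1 * v2) + w13 * (z * (v1\<^sup>2 + v3\<^sup>2) - 2 * v1 * v3)
      + w23 * (y * (v2\<^sup>2 + v3\<^sup>2) - 2 * v2 * v3)"
  proof cases
    case 1
    then show ?thesis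
      using hyp_form_pos_of_two_weights[OF C S CS x_def y_def z_def gt1 D w_eq _ _ v] sgn by simp
  next
    case 2
    have "0 < w13 * (z * (v1\<^sup>2 + v3\<^sup>2) - 2 * v1 * v3) + w12 * (x * (v1\<^sup>2 + v2\<^sup>2) - 2 * v1 * v2)
      + w23 * (y * (v3\<^sup>2 + v2\<^sup>2) - 2 * v3 * v2)"
    proof (rule s23.hyp_form_pos_of_two_weights[OF C(1) C(3) C(2) S(1) S(3) S(2) CS(1) CS(3) CS(2)])
      show "0 < 1 + 2 * z * y * x - z\<^sup>2 - y\<^sup>2 - x\<^sup>2" using D by (simp add: mult_ac)
      show "w12 * (x\<^sup>2 - 1) = C1 * (y * x - z) + C2 * (z * x - y) - C3 * (x\<^sup>2 - 1)"
        "w13 * (z\<^sup>2 - 1) = C1 * (z * y - x) + C3 * (z * x - y) - C2 * (z\<^sup>2 - 1)"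
        "w23 * (y\<^sup>2 - 1) = C3 * (y * x - z) + C2 * (z * y - x) - C1 * (y\<^sup>2 - 1)"
        unfolding w_eq by (simp_all add: mult.commute)
      show "0 < w12" "0 < w23" using 2 sgn by simp_all
      show "v1 \<noteq> 0 \<or> v3 \<noteq> 0 \<or> v2 \<noteq> 0" using v by blast
    qed (rule x_def z_def swapped gt1)+
    then show ?thesis by (simp add: algebra_simps)
  next
    case 3
    have "0 < w23 * (y * (v3\<^sup>2 + v2\<^sup>2) - 2 * v3 * v2) + w13 * (z * (v3\<^sup>2 + v1\<^sup>2) - 2 * v3 * v1)
      + w12 * (x * (v2\<^sup>2 + v1\<^sup>2) - 2 * v2 * v1)"
    proof (rule s13.hyp_form_pos_of_two_weights[OF C(3) C(2) C(1) S(3) S(2) S(1) CS(3) CS(2) CS(1)])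
      show "0 < 1 + 2 * y * x * z - y\<^sup>2 - x\<^sup>2 - z\<^sup>2" using D by (simp add: mult_ac)
      show "w23 * (y\<^sup>2 - 1) = C3 * (y * x - z) + C2 * (y * z - x) - C1 * (y\<^sup>2 - 1)"
        "w13 * (z\<^sup>2 - 1) = C3 * (x * z - y) + C1 * (y * z - x) - C2 * (z\<^sup>2 - 1)"
        "w12 * (x\<^sup>2 - 1) = C2 * (x * z - y) + C1 * (y * x - z) - C3 * (x\<^sup>2 - 1)"
        unfolding w_eq by (simp_all add: mult.commute)
      show "0 < w13" "0 < w12" using 3 sgn by simp_all
      show "v3 \<noteq> 0 \<or> v2 \<noteq> 0 \<or> v1 \<noteq> 0" using v by blast
    qed (rule swapped gt1)+
    then show ?thesis by (simp add: algebra_simps)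
  qed
  then show ?thesis
    unfolding X_def Y_def Z_def using hyp_energy_identity[OF gt1 w_eq x' y' z'] by simp
qed

end

section \<open>The derivative of the angles of a Euclidean triangle\<close>

context inversive_triple begin

text \<open>Here \<open>x, y, z\<close> are the squared lengths of the edges \<open>12, 23, 13\<close>, and \<open>n\<^sub>i\<close> is the inner product of the two
  edge vectors at the vertex \<open>i\<close>. The expression is the derivative of \<open>- \<Sum>\<^sub>i v\<^sub>i \<theta>\<^sub>i\<close> in the direction \<open>v\<close>, up to a
  positive factor. In contrast to the hyperbolic case the form vanishes on constant vectors, because
  scaling a triangle preserves its angles, and it is a weighted sum of squared differences.\<close>

lemma eucl_angle_form_pos:
  fixes r1 r2 r3 :: real
  assumes r: "0 < r1" "0 < r2" "0 < r3"
    and x_def: "x = r1\<^sup>2 + r2\<^sup>2 + 2 * a * r1 * r2" and y_def: "y = r2\<^sup>2 + r3\<^sup>2 + 2 * b * r2 * r3"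
    and z_def: "z = r1\<^sup>2 + r3\<^sup>2 + 2 * c * r1 * r3"
    and n: "n1 = (x + z - y) / 2" "n2 = (x + y - z) / 2" "n3 = (y + z - x) / 2"
    and pos: "0 < x" "0 < y" "0 < z" and D: "0 < x * z - n1\<^sup>2"
    and x': "x' = 2 * (r1 * (r1 + a * r2) * v1 + r2 * (r2 + a * r1) * v2)"
    and y': "y' = 2 * (r2 * (r2 + b * r3) * v2 + r3 * (r3 + b * r2) * v3)"
    and z': "z' = 2 * (r1 * (r1 + c * r3) * v1 + r3 * (r3 + c * r1) * v3)"
    and v: "v1 \<noteq> v2 \<or> v2 \<noteq> v3"
  shows "0 < v1 * (n2 * x' / x - y' + n3 * z' / z) + v2 * (n1 * x' / x - z' + n3 * y' / y)
      + v3 * (n1 * z' / z - x' + n2 * y' / y)"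
proof -
  define D12 D21 D23 D32 D13 D31 where "D12 = r1 * (r1 + a * r2)" and "D21 = r2 * (r2 + a * r1)"
    and "D23 = r2 * (r2 + b * r3)" and "D32 = r3 * (r3 + b * r2)"
    and "D13 = r1 * (r1 + c * r3)" and "D31 = r3 * (r3 + c * r1)"
  note D_defs = D12_def D21_def D23_def D32_def D13_def D31_def
  define w12 w13 w23 where "w12 = (x * D23 - n2 * D21) / x" and "w13 = (z * D32 - n3 * D31) / z"
    and "w23 = (y * D31 - n3 * D32) / y"
  have w_eq: "w12 * x = x * D23 - n2 * D21" "w13 * z = z * D32 - n3 * D31" "w23 * y = y * D31 - n3 * D32"
    using pos by (simp_all add: w12_def w13_def w23_def)
  have n': "2 * n1 = x + z - y" "2 * n2 = x + y - z" "2 * n3 = y + z - x" using n by simp_all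
  \<comment> \<open>These are \<open>1 / r\<^sub>i\<close>, multiplied by \<open>r1 * r2 * r3\<close>.\<close>
  define k1 k2 k3 where "k1 = r2 * r3" and "k2 = r1 * r3" and "k3 = r1 * r2"
  have k: "0 < k1" "0 < k2" "0 < k3" using r by (simp_all add: k1_def k2_def k3_def)
  define h1 h2 h3 where "h1 = k1 * (1 - b\<^sup>2) + k2 * (a + b * c) + k3 * (c + a * b)"
    and "h2 = k2 * (1 - c\<^sup>2) + k1 * (a + b * c) + k3 * (b + a * c)"
    and "h3 = k3 * (1 - a\<^sup>2) + k1 * (c + a * b) + k2 * (b + a * c)"
  have "w12 * x = r1 * r2 * h3" "w13 * z = r1 * r3 * h2" "w23 * y = r2 * r3 * h1"
    using n' unfolding w_eq
    unfolding x_def y_def z_def h1_def h2_def h3_def k1_def k2_def k3_def D_defs by algebra+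
  then have sgn: "0 < w12 \<longleftrightarrow> 0 < h3" "0 < w13 \<longleftrightarrow> 0 < h2" "0 < w23 \<longleftrightarrow> 0 < h1"
    using pos r by (metis mult_pos_pos zero_less_mult_pos zero_less_mult_pos2)+
  interpret s13: inversive_triple b a c by (rule inversive_triple_swap13) unfold_locales
  interpret s23: inversive_triple c b a by (rule inversive_triple_swap23) unfold_locales
  have "\<not> (h1 \<le> 0 \<and> h2 \<le> 0)"
    using at_most_one_nonpos_height[OF k] by (auto simp: h1_def h2_def)
  moreover have "\<not> (h1 \<le> 0 \<and> h3 \<le> 0)"
    using s23.at_most_one_nonpos_height[OF k(1) k(3) k(2)] by (auto simp: h1_def h3_def add_ac mult_ac)
  moreover have "\<not> (h3 \<le> 0 \<and> h2 \<le> 0)"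
    using s13.at_most_one_nonpos_height[OF k(3) k(2) k(1)] by (auto simp: h2_def h3_def add_ac mult_ac)
  ultimately have two: "0 < w13 \<and> 0 < w23 \<or> 0 < w12 \<and> 0 < w23 \<or> 0 < w12 \<and> 0 < w13"
    unfolding sgn by linarith
  have "D12 * D23 * D31 + D21 * D32 * D13 = r1 * r2 * r3 * ((r1 + a * r2) * (r2 + b * r3) * (r3 + c * r1)
      + (r2 + a * r1) * (r3 + b * r2) * (r1 + c * r3))"
    unfolding D_defs by algebra
  moreover have "0 < \<dots>" using length_jacobian_pos[OF r] r by (simp add: add_ac)
  ultimately have dd: "0 < D12 * D23 * D31 + D21 * D32 * D13" by simp
  have lens: "x = D12 + D21" "y = D23 + D32" "z = D13 + D31"
    unfolding x_def y_def z_def D_defs by algebra+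
  \<comment> \<open>The feet of the perpendiculars from the radical centre satisfy the relation of Carnot, because \<open>D12 - D21 = r1\<^sup>2 - r2\<^sup>2\<close>.\<close>
  have ceva: "D12 - D21 + D23 - D32 + D31 - D13 = 0"
    unfolding D_defs by algebra
  have "x * y * z * (w12 * w13 + w12 * w23 + w13 * w23)
      = (w12 * x) * (w13 * z) * y + (w12 * x) * (w23 * y) * z + (w13 * z) * (w23 * y) * x" by algebra
  also have "\<dots> = (x * z - n1\<^sup>2) * (D12 * D23 * D31 + D21 * D32 * D13)"
    unfolding w_eq using n' lens ceva by algebra
  finally have "0 < x * y * z * (w12 * w13 + w12 * w23 + w13 * w23)" using D dd by simp
  then have e2: "0 < w12 * w13 + w12 * w23 + w13 * w23"
    using pos by (metis mult_pos_pos zero_less_mult_pos)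
  define iX iY iZ where "iX = 1 / x" and "iY = 1 / y" and "iZ = 1 / z"
  have i: "x * iX = 1" "y * iY = 1" "z * iZ = 1" using pos by (simp_all add: iX_def iY_def iZ_def)
  have x'': "x' = 2 * (D12 * v1 + D21 * v2)" "y' = 2 * (D23 * v2 + D32 * v3)" "z' = 2 * (D13 * v1 + D31 * v3)"
    by (simp_all add: x' y' z' D_defs)
  have "v1 * (n2 * x' * iX - y' + n3 * z' * iZ) + v2 * (n1 * x' * iX - z' + n3 * y' * iY)
      + v3 * (n1 * z' * iZ - x' + n2 * y' * iY)
    = 2 * (w12 * (v1 - v2)\<^sup>2 + w13 * (v1 - v3)\<^sup>2 + w23 * (v2 - v3)\<^sup>2)"
    using i w_eq n' lens ceva unfolding x'' by algebra
  moreover have "0 < \<dots>" using weighted_differences_pos[OF e2 two v] by simp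
  ultimately show ?thesis by (simp add: iX_def iY_def iZ_def)
qed
end

section \<open>Monotonicity of angles along a path that may leave the admissible space\<close>

lemma open_interval_avoiding_finite:
  fixes \<alpha> \<beta> :: real
  assumes "finite S" "\<alpha> < \<beta>"
  obtains c d where "\<alpha> < c" "c < d" "d < \<beta>" "S \<inter> {c..d} = {}"
proof -
  define m where "m = Max (insert \<alpha> (S \<inter> {..<\<beta>}))"
  have fin: "finite (insert \<alpha> (S \<inter> {..<\<beta>}))" using assms by simp
  have "m \<in> insert \<alpha> (S \<inter> {..<\<beta>})" unfolding m_def by (rule Max_in) (use fin in auto)
  then have m: "m < \<beta>" using assms by auto
  have "\<alpha> \<le> m" unfolding m_def using fin by simp
  have "s \<le> m" if "s \<in> S" "s < \<beta>" for s unfolding m_def using fin that by (intro Max_ge) auto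
  then have *: "S \<inter> {(2 * m + \<beta>) / 3..(m + 2 * \<beta>) / 3} = {}"
    using m by (auto simp: field_simps) (smt (verit))
  show ?thesis
    by (rule that[of "(2 * m + \<beta>) / 3" "(m + 2 * \<beta>) / 3"]) (use * m \<open>\<alpha> \<le> m\<close> in auto)
qed

text \<open>Otherwise there is an interval \<open>{c..d}\<close> between \<open>g s\<close> and \<open>g e\<close> that contains no exceptional value. After
  the last time \<open>t0\<close> with \<open>g t0 \<le> c\<close> and up to the first subsequent time \<open>t1\<close> with \<open>d \<le> g t1\<close>, the values
  of \<open>g\<close> stay in this interval, so that \<open>g\<close> decreases from \<open>t0\<close> to \<open>t1\<close>, a contradiction.\<close>

lemma decreasing_of_finite_exceptional_values:
  fixes g :: "real \<Rightarrow> real"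
  assumes cont: "continuous_on {s..e} g" and "s \<le> e"
    and fin: "finite (g ` ({s..e} - A))"
    and deriv: "\<And>t. t \<in> {s..e} \<inter> A \<Longrightarrow> \<exists>D<0. (g has_real_derivative D) (at t)"
  shows "g e \<le> g s"
proof (rule ccontr)
  assume "\<not> ?thesis"
  then have "g s < g e" by simp
  from open_interval_avoiding_finite[OF fin this] obtain c d
    where cd: "g s < c" "c < d" "d < g e" and avoid: "g ` ({s..e} - A) \<inter> {c..d} = {}" by blast
  have "closed ({s..e} \<inter> g -` {..c})" by (rule continuous_closed_preimage[OF cont]) auto
  then have "compact ({s..e} \<inter> g -` {..c})" by (meson bounded_Int bounded_closed_interval compact_eq_bounded_closed)
  moreover have "s \<in> {s..e} \<inter> g -` {..c}" using cd \<open>s \<le> e\<close> by simp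
  ultimately obtain t0 where "t0 \<in> {s..e} \<inter> g -` {..c}" "\<forall>t\<in>{s..e} \<inter> g -` {..c}. t \<le> t0"
    using compact_attains_sup[of "{s..e} \<inter> g -` {..c}"] by blast
  then have t0: "t0 \<in> {s..e}" "g t0 \<le> c" and t0_max: "\<And>t. t \<in> {s..e} \<Longrightarrow> g t \<le> c \<Longrightarrow> t \<le> t0"
    by auto
  have cont0: "continuous_on {t0..e} g" using cont t0 by (auto intro: continuous_on_subset)
  then have "closed ({t0..e} \<inter> g -` {d..})" by (rule continuous_closed_preimage) auto
  then have "compact ({t0..e} \<inter> g -` {d..})" by (meson bounded_Int bounded_closed_interval compact_eq_bounded_closed)
  moreover have "e \<in> {t0..e} \<inter> g -` {d..}" using cd t0 by simp
  ultimately obtain t1 where "t1 \<in> {t0..e} \<inter> g -` {d..}" "\<forall>t\<in>{t0..e} \<inter> g -` {d..}. t1 \<le> t"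
    using compact_attains_inf[of "{t0..e} \<inter> g -` {d..}"] by blast
  then have t1: "t1 \<in> {t0..e}" "d \<le> g t1" and t1_min: "\<And>t. t \<in> {t0..e} \<Longrightarrow> d \<le> g t \<Longrightarrow> t1 \<le> t"
    by auto
  have "t0 < t1" using t0 t1 cd by (cases "t0 = t1") auto
  have "g t1 < g t0"
  proof (rule DERIV_neg_imp_decreasing_open[OF \<open>t0 < t1\<close>])
    fix t assume t: "t0 < t" "t < t1"
    then have "t \<in> {s..e}" "t \<in> {t0..e}" using t0 t1 by auto
    then have "\<not> g t \<le> c" "\<not> d \<le> g t" using t t0_max[of t] t1_min[of t] by auto
    then have "g t \<in> {c..d}" by simp
    then have "t \<in> A" using avoid \<open>t \<in> {s..e}\<close> by blast
    then show "\<exists>D. (g has_real_derivative D) (at t) \<and> D < 0"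
      using deriv[of t] \<open>t \<in> {s..e}\<close> by blast
  next
    show "continuous_on {t0..t1} g" using cont0 t1 by (auto intro: continuous_on_subset)
  qed
  then show False using t0 t1 cd by simp
qed

text \<open>Continuity of \<open>\<Delta>\<close> gives an initial interval without exceptional points, and strictness comes from it.\<close>

lemma strictly_decreasing_of_finite_exceptional_values:
  fixes g \<Delta> :: "real \<Rightarrow> real"
  assumes cont: "continuous_on {0..1} g" and cont\<Delta>: "continuous_on {0..1} \<Delta>" and "0 < \<Delta> 0"
    and fin: "finite (g ` {t \<in> {0..1}. \<Delta> t \<le> 0})"
    and deriv: "\<And>t. t \<in> {0..1} \<Longrightarrow> 0 < \<Delta> t \<Longrightarrow> \<exists>D<0. (g has_real_derivative D) (at t)"
  shows "g 1 < g 0"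
proof -
  obtain d where d: "0 < d" "\<And>t. t \<in> {0..1} \<Longrightarrow> dist t 0 < d \<Longrightarrow> dist (\<Delta> t) (\<Delta> 0) < \<Delta> 0"
    using cont\<Delta>[unfolded continuous_on_iff, rule_format, of 0 "\<Delta> 0"] \<open>0 < \<Delta> 0\<close> by auto
  define \<epsilon> where "\<epsilon> = min 1 (d / 2)"
  have \<epsilon>: "0 < \<epsilon>" "\<epsilon> \<le> 1" "\<epsilon> < d" using d by (auto simp: \<epsilon>_def)
  have pos: "0 < \<Delta> t" if "t \<in> {0..\<epsilon>}" for t
    using d(2)[of t] that \<epsilon> by (auto simp: dist_real_def)
  have "g \<epsilon> < g 0"
  proof (rule DERIV_neg_imp_decreasing_open[OF \<epsilon>(1)])
    fix t assume "0 < t" "t < \<epsilon>"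
    then show "\<exists>D. (g has_real_derivative D) (at t) \<and> D < 0"
      using deriv[of t] pos[of t] \<epsilon> by auto
  next
    show "continuous_on {0..\<epsilon>} g" by (rule continuous_on_subset[OF cont]) (use \<epsilon> in auto)
  qed
  moreover have "g 1 \<le> g \<epsilon>"
  proof (rule decreasing_of_finite_exceptional_values[where g = g and s = \<epsilon> and e = 1 and A = "{t. 0 < \<Delta> t}"])
    show "finite (g ` ({\<epsilon>..1} - {t. 0 < \<Delta> t}))"
      by (rule finite_subset[OF _ fin]) (use \<epsilon> in auto)
  qed (use deriv \<epsilon> continuous_on_subset[OF cont, of "{\<epsilon>..1}"] in auto)
  ultimately show ?thesis by simp
qed

text \<open>The angle between two vectors with inner product \<open>n\<close> and product \<open>P\<close> of their squared norms. Truncating the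
  cosine extends it continuously by 0 and \<open>\<pi>\<close> to data that violate the Cauchy-Schwarz inequality \<open>n\<^sup>2 \<le> P\<close>.\<close>

definition clamped_angle :: "real \<Rightarrow> real \<Rightarrow> real" where
  "clamped_angle n P = arccos (max (- 1) (min 1 (n / sqrt P)))"

lemma abs_less_sqrt_of_square_less: "n\<^sup>2 < P \<Longrightarrow> \<bar>n\<bar> < sqrt P" for n P :: real
  by (simp add: real_less_rsqrt)

lemma clamped_angle_eq:
  assumes "n\<^sup>2 < P"
  shows "clamped_angle n P = arccos (n / sqrt P)" "-1 < n / sqrt P" "n / sqrt P < 1"
proof -
  have "0 < sqrt P" using assms by (metis abs_ge_zero abs_less_sqrt_of_square_less order_le_less_trans)
  moreover have "\<bar>n\<bar> < sqrt P" using assms by (rule abs_less_sqrt_of_square_less)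
  ultimately have "\<bar>n / sqrt P\<bar> < 1" by simp
  then show "-1 < n / sqrt P" "n / sqrt P < 1" by linarith+
  then show "clamped_angle n P = arccos (n / sqrt P)" by (simp add: clamped_angle_def)
qed

lemma clamped_angle_degenerate:
  assumes "0 < P" "P \<le> n\<^sup>2"
  shows "clamped_angle n P \<in> {0, pi}"
proof -
  have "sqrt P \<le> \<bar>n\<bar>" using assms real_sqrt_le_mono[of P "n\<^sup>2"] by simp
  then have "1 \<le> \<bar>n / sqrt P\<bar>" using assms by simp
  then have "n / sqrt P \<le> -1 \<or> 1 \<le> n / sqrt P" by linarith
  then show ?thesis by (auto simp: clamped_angle_def)
qed

lemma continuous_on_clamped_angle:
  assumes "continuous_on T n" "continuous_on T P" "\<And>t. t \<in> T \<Longrightarrow> 0 < P t"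
  shows "continuous_on T (\<lambda>t. clamped_angle (n t) (P t))"
  unfolding clamped_angle_def
  by (intro continuous_on_arccos continuous_intros assms ballI) (use assms(3) in \<open>simp_all add: less_imp_neq[symmetric]\<close>)

lemma has_derivative_clamped_angle:
  assumes n: "(n has_real_derivative n') (at t)"
    and p: "(p has_real_derivative p') (at t)" and q: "(q has_real_derivative q') (at t)"
    and pos: "0 < p t" "0 < q t" and less: "(n t)\<^sup>2 < p t * q t"
  shows "((\<lambda>t. clamped_angle (n t) (p t * q t)) has_real_derivative
      - (n' - n t * (p' / p t + q' / q t) / 2) / sqrt (p t * q t - (n t)\<^sup>2)) (at t)"
proof -
  define f where "f = (\<lambda>t. n t / sqrt (p t * q t))"
  define R where "R = sqrt (p t * q t)"
  have R: "0 < R" "R\<^sup>2 = p t * q t" using pos by (simp_all add: R_def)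
  have pq: "((\<lambda>t. p t * q t) has_real_derivative p' * q t + q' * p t) (at t)"
    by (rule DERIV_mult[OF p q])
  have "((\<lambda>t. sqrt (p t * q t)) has_real_derivative (inverse R / 2) * (p' * q t + q' * p t)) (at t)"
    unfolding R_def by (rule DERIV_chain'[OF pq DERIV_real_sqrt]) (use pos in simp)
  from DERIV_divide[OF n this] have f: "(f has_real_derivative
      (n' * R - n t * ((inverse R / 2) * (p' * q t + q' * p t))) / (R * R)) (at t)"
    using R pos unfolding f_def R_def by simp
  have f_eq: "(n' * R - n t * ((inverse R / 2) * (p' * q t + q' * p t))) / (R * R)
    = (n' - n t * (p' / p t + q' / q t) / 2) / R"
  proof -
    have "p' / p t + q' / q t = (p' * q t + q' * p t) / R\<^sup>2" using R pos by (simp add: field_simps)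
    then show ?thesis using R(1) by (simp only:) (simp add: field_simps power2_eq_square)
  qed
  have ft: "-1 < f t" "f t < 1" using clamped_angle_eq(2,3)[OF less] by (simp_all add: f_def)
  have "f t = n t / R" by (simp only: f_def R_def)
  then have "1 - (f t)\<^sup>2 = (p t * q t - (n t)\<^sup>2) / R\<^sup>2"
    unfolding R(2)[symmetric] using R(1) by (simp add: power_divide diff_divide_distrib)
  then have s: "sqrt (1 - (f t)\<^sup>2) = sqrt (p t * q t - (n t)\<^sup>2) / R"
    using R(1) by (simp add: real_sqrt_divide)
  have "((\<lambda>t. arccos (f t)) has_real_derivative
      inverse (- sqrt (1 - (f t)\<^sup>2)) * ((n' - n t * (p' / p t + q' / q t) / 2) / R)) (at t)"
    using DERIV_chain'[OF f[unfolded f_eq] DERIV_arccos[OF ft]] by simp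
  moreover have "inverse (- sqrt (1 - (f t)\<^sup>2)) * ((n' - n t * (p' / p t + q' / q t) / 2) / R)
      = - (n' - n t * (p' / p t + q' / q t) / 2) / sqrt (p t * q t - (n t)\<^sup>2)"
    unfolding s using R(1) by (simp add: divide_simps)
  ultimately have der: "((\<lambda>t. arccos (f t)) has_real_derivative
      - (n' - n t * (p' / p t + q' / q t) / 2) / sqrt (p t * q t - (n t)\<^sup>2)) (at t)" by simp
  have "(\<lambda>t. p t * q t - (n t)\<^sup>2) \<midarrow>t\<rightarrow> p t * q t - (n t)\<^sup>2"
    using DERIV_isCont[OF n] DERIV_isCont[OF p] DERIV_isCont[OF q] unfolding isCont_def
    by (intro tendsto_intros)
  then have "\<forall>\<^sub>F s in at t. 0 < p s * q s - (n s)\<^sup>2"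
    by (rule order_tendstoD(1)) (use less in simp)
  then have "\<forall>\<^sub>F s in nhds t. 0 < p s * q s - (n s)\<^sup>2"
    unfolding eventually_nhds_conv_at using less by simp
  then have "\<forall>\<^sub>F s in nhds t. clamped_angle (n s) (p s * q s) = arccos (f s)"
    by (rule eventually_mono) (simp add: clamped_angle_eq(1) f_def)
  from DERIV_cong_ev[OF refl this refl] der show ?thesis by (rule iffD2)
qed

text \<open>At the vertices 1, 2, 3 of a moving triangle, \<open>n\<^sub>i\<close> is the inner product of the two edge directions, and
  \<open>p, q, s\<close> are the squared norms belonging to the edges \<open>12, 13, 23\<close>. The Gram determinant \<open>\<Delta>\<close> is the same at all three
  vertices, so that the three angles degenerate at the same times. The form in the last assumption is
  \<open>sqrt \<Delta>\<close> times the derivative of \<open>- \<Sum>\<^sub>i v\<^sub>i \<theta>\<^sub>i\<close>.\<close>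

lemma triangle_angles_monotone:
  fixes n1 n2 n3 p q s p' q' s' :: "real \<Rightarrow> real"
  assumes deriv: "\<And>t. t \<in> {0..1} \<Longrightarrow> (p has_real_derivative p' t) (at t)"
      "\<And>t. t \<in> {0..1} \<Longrightarrow> (q has_real_derivative q' t) (at t)"
      "\<And>t. t \<in> {0..1} \<Longrightarrow> (s has_real_derivative s' t) (at t)"
      "\<And>t. t \<in> {0..1} \<Longrightarrow> (n1 has_real_derivative n1' t) (at t)"
      "\<And>t. t \<in> {0..1} \<Longrightarrow> (n2 has_real_derivative n2' t) (at t)"
      "\<And>t. t \<in> {0..1} \<Longrightarrow> (n3 has_real_derivative n3' t) (at t)"
    and pos: "\<And>t. t \<in> {0..1} \<Longrightarrow> 0 < p t" "\<And>t. t \<in> {0..1} \<Longrightarrow> 0 < q t" "\<And>t. t \<in> {0..1} \<Longrightarrow> 0 < s t"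
    and \<Delta>: "\<And>t. p t * q t - (n1 t)\<^sup>2 = \<Delta> t" "\<And>t. p t * s t - (n2 t)\<^sup>2 = \<Delta> t" "\<And>t. q t * s t - (n3 t)\<^sup>2 = \<Delta> t"
    and "0 < \<Delta> 0"
    and form: "\<And>t. t \<in> {0..1} \<Longrightarrow> 0 < \<Delta> t \<Longrightarrow>
      0 < v1 * (n1' t - n1 t * (p' t / p t + q' t / q t) / 2)
        + v2 * (n2' t - n2 t * (p' t / p t + s' t / s t) / 2)
        + v3 * (n3' t - n3 t * (q' t / q t + s' t / s t) / 2)"
  shows "v1 * clamped_angle (n1 1) (p 1 * q 1) + v2 * clamped_angle (n2 1) (p 1 * s 1)
      + v3 * clamped_angle (n3 1) (q 1 * s 1)
    < v1 * clamped_angle (n1 0) (p 0 * q 0) + v2 * clamped_angle (n2 0) (p 0 * s 0)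
      + v3 * clamped_angle (n3 0) (q 0 * s 0)"
proof -
  define g where "g = (\<lambda>t. v1 * clamped_angle (n1 t) (p t * q t) + v2 * clamped_angle (n2 t) (p t * s t)
      + v3 * clamped_angle (n3 t) (q t * s t))"
  have cont: "continuous_on {0..1} p" "continuous_on {0..1} q" "continuous_on {0..1} s"
    "continuous_on {0..1} n1" "continuous_on {0..1} n2" "continuous_on {0..1} n3"
    using deriv by (meson DERIV_isCont continuous_at_imp_continuous_on)+
  have \<Delta>_eq: "\<Delta> = (\<lambda>t. p t * q t - (n1 t)\<^sup>2)" using \<Delta>(1) by auto
  have "g 1 < g 0"
  proof (rule strictly_decreasing_of_finite_exceptional_values[where g = g and \<Delta> = \<Delta>])
    show "continuous_on {0..1} g"
      unfolding g_def by (intro continuous_intros continuous_on_clamped_angle cont mult_pos_pos pos)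
    show "continuous_on {0..1} \<Delta>" unfolding \<Delta>_eq by (intro continuous_intros cont)
    show "finite (g ` {t \<in> {0..1}. \<Delta> t \<le> 0})"
    proof (rule finite_subset)
      show "g ` {t \<in> {0..1}. \<Delta> t \<le> 0} \<subseteq>
        (\<lambda>(e1, e2, e3). v1 * e1 + v2 * e2 + v3 * e3) ` ({0, pi} \<times> {0, pi} \<times> {0, pi})"
      proof (rule image_subsetI)
        fix t assume "t \<in> {t \<in> {0..1}. \<Delta> t \<le> 0}"
        then have t: "t \<in> {0..1}" "\<Delta> t \<le> 0" by auto
        have "clamped_angle (n1 t) (p t * q t) \<in> {0, pi}" "clamped_angle (n2 t) (p t * s t) \<in> {0, pi}"
          "clamped_angle (n3 t) (q t * s t) \<in> {0, pi}"
          using t(2) pos[OF t(1)] \<Delta>[of t] by (intro clamped_angle_degenerate mult_pos_pos; linarith)+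
        then show "g t \<in> (\<lambda>(e1, e2, e3). v1 * e1 + v2 * e2 + v3 * e3) ` ({0, pi} \<times> {0, pi} \<times> {0, pi})"
          unfolding g_def
          by (intro image_eqI[where x = "(clamped_angle (n1 t) (p t * q t), clamped_angle (n2 t) (p t * s t),
            clamped_angle (n3 t) (q t * s t))"]) auto
      qed
    qed simp
    show "0 < \<Delta> 0" by fact
  next
    fix t :: real assume t: "t \<in> {0..1}" "0 < \<Delta> t"
    define R where "R = sqrt (\<Delta> t)"
    have R: "0 < R" using t by (simp add: R_def)
    define a1 a2 a3 where "a1 = n1' t - n1 t * (p' t / p t + q' t / q t) / 2"
      and "a2 = n2' t - n2 t * (p' t / p t + s' t / s t) / 2"
      and "a3 = n3' t - n3 t * (q' t / q t + s' t / s t) / 2"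
    note posn = pos[OF t(1)]
    have lt: "(n1 t)\<^sup>2 < p t * q t" "(n2 t)\<^sup>2 < p t * s t" "(n3 t)\<^sup>2 < q t * s t"
      using t(2) \<Delta>[of t] by linarith+
    have d: "((\<lambda>t. clamped_angle (n1 t) (p t * q t)) has_real_derivative - a1 / R) (at t)"
      "((\<lambda>t. clamped_angle (n2 t) (p t * s t)) has_real_derivative - a2 / R) (at t)"
      "((\<lambda>t. clamped_angle (n3 t) (q t * s t)) has_real_derivative - a3 / R) (at t)"
      unfolding a1_def a2_def a3_def R_def
      using has_derivative_clamped_angle[OF deriv(4)[OF t(1)] deriv(1)[OF t(1)] deriv(2)[OF t(1)] posn(1,2) lt(1)]
        has_derivative_clamped_angle[OF deriv(5)[OF t(1)] deriv(1)[OF t(1)] deriv(3)[OF t(1)] posn(1,3) lt(2)]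
        has_derivative_clamped_angle[OF deriv(6)[OF t(1)] deriv(2)[OF t(1)] deriv(3)[OF t(1)] posn(2,3) lt(3)]
      by (simp_all only: \<Delta>)
    have "(g has_real_derivative v1 * (- a1 / R) + v2 * (- a2 / R) + v3 * (- a3 / R)) (at t)"
      unfolding g_def by (intro DERIV_add DERIV_cmult d)
    moreover have "v1 * (- a1 / R) + v2 * (- a2 / R) + v3 * (- a3 / R) = - (v1 * a1 + v2 * a2 + v3 * a3) / R"
      by (simp add: diff_divide_distrib add_divide_distrib)
    moreover have "- (v1 * a1 + v2 * a2 + v3 * a3) / R < 0"
      using form[OF t] R unfolding a1_def a2_def a3_def by (simp add: divide_neg_pos)
    ultimately show "\<exists>D<0. (g has_real_derivative D) (at t)" by metis
  qed
  then show ?thesis by (simp add: g_def)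
qed

section \<open>Monotonicity of the angles of a face in the radii\<close>

text \<open>The law of cosines for the angle between sides with squared lengths \<open>x\<close>, \<open>z\<close> and opposite squared
  length \<open>y\<close>, continued to degenerate triangles.\<close>

definition eucl_angle_of_squares :: "real \<Rightarrow> real \<Rightarrow> real \<Rightarrow> real" where
  "eucl_angle_of_squares x z y = clamped_angle ((x + z - y) / 2) (x * z)"

text \<open>The hyperbolic law of cosines for the angle between sides whose lengths have hyperbolic cosines \<open>x\<close>, \<open>z\<close>,
  opposite to the side with hyperbolic cosine \<open>y\<close>, continued to degenerate triangles.\<close>

definition hyp_angle_of_cosh :: "real \<Rightarrow> real \<Rightarrow> real \<Rightarrow> real" where
  "hyp_angle_of_cosh x z y = clamped_angle (x * z - y) ((x\<^sup>2 - 1) * (z\<^sup>2 - 1))"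

abbreviation eucl_square :: "real \<Rightarrow> real \<Rightarrow> real \<Rightarrow> real" where
  "eucl_square a r s \<equiv> r\<^sup>2 + s\<^sup>2 + 2 * r * s * a"

abbreviation hyp_cosh :: "real \<Rightarrow> real \<Rightarrow> real \<Rightarrow> real" where
  "hyp_cosh a r s \<equiv> cosh r * cosh s + a * sinh r * sinh s"

lemma eucl_square_pos:
  assumes "0 < r" "0 < s" "-1 < a"
  shows "(r - s)\<^sup>2 < eucl_square a r s"
proof -
  have "0 < 2 * r * s * (1 + a)" using assms by simp
  then show ?thesis by (simp add: power2_eq_square algebra_simps)
qed

lemma hyp_cosh_gt_cosh_diff:
  assumes "0 < r" "0 < s" "-1 < a"
  shows "cosh (r - s) < hyp_cosh a r s"
proof -
  have "0 < sinh r * sinh s * (1 + a)" using assms by simp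
  then show ?thesis by (simp add: cosh_diff algebra_simps)
qed

lemma hyp_cosh_gt_1:
  assumes "0 < r" "0 < s" "-1 < a"
  shows "1 < hyp_cosh a r s"
  using hyp_cosh_gt_cosh_diff[OF assms] cosh_real_ge_1[of "r - s"] by linarith

context inversive_triple begin

text \<open>Only the initial triangle has to be nondegenerate: the angles are followed along the segment
  between the logarithms of the radii.\<close>

lemma eucl_face_monotone:
  assumes r: "0 < r1" "0 < r2" "0 < r3" and s: "0 < s1" "0 < s2" "0 < s3"
    and x: "x = eucl_square a r1 r2" and y: "y = eucl_square b r2 r3" and z: "z = eucl_square c r1 r3"
    and x': "x' = eucl_square a s1 s2" and y': "y' = eucl_square b s2 s3" and z': "z' = eucl_square c s1 s3"
    and nondegenerate: "((x + z - y) / 2)\<^sup>2 < x * z"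
    and ne: "ln s1 - ln r1 \<noteq> ln s2 - ln r2 \<or> ln s2 - ln r2 \<noteq> ln s3 - ln r3"
  shows "(ln s1 - ln r1) * eucl_angle_of_squares x' z' y' + (ln s2 - ln r2) * eucl_angle_of_squares x' y' z'
      + (ln s3 - ln r3) * eucl_angle_of_squares z' y' x'
    < (ln s1 - ln r1) * eucl_angle_of_squares x z y + (ln s2 - ln r2) * eucl_angle_of_squares x y z
      + (ln s3 - ln r3) * eucl_angle_of_squares z y x"
proof -
  define v1 v2 v3 where "v1 = ln s1 - ln r1" and "v2 = ln s2 - ln r2" and "v3 = ln s3 - ln r3"
  define R1 R2 R3 where "R1 = (\<lambda>t. exp (ln r1 + t * v1))" and "R2 = (\<lambda>t. exp (ln r2 + t * v2))"
    and "R3 = (\<lambda>t. exp (ln r3 + t * v3))"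
  have R_pos: "0 < R1 t" "0 < R2 t" "0 < R3 t" for t by (simp_all add: R1_def R2_def R3_def)
  have R_ends: "R1 0 = r1" "R2 0 = r2" "R3 0 = r3" "R1 1 = s1" "R2 1 = s2" "R3 1 = s3"
    using r s by (simp_all add: R1_def R2_def R3_def v1_def v2_def v3_def)
  have dR: "(R1 has_real_derivative R1 t * v1) (at t)" "(R2 has_real_derivative R2 t * v2) (at t)"
    "(R3 has_real_derivative R3 t * v3) (at t)" for t
    unfolding R1_def R2_def R3_def by (auto intro!: derivative_eq_intros)
  define X Y Z where "X = (\<lambda>t. eucl_square a (R1 t) (R2 t))" and "Y = (\<lambda>t. eucl_square b (R2 t) (R3 t))"
    and "Z = (\<lambda>t. eucl_square c (R1 t) (R3 t))"
  define X' Y' Z' where "X' = (\<lambda>t. 2 * (R1 t * (R1 t + a * R2 t) * v1 + R2 t * (R2 t + a * R1 t) * v2))"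
    and "Y' = (\<lambda>t. 2 * (R2 t * (R2 t + b * R3 t) * v2 + R3 t * (R3 t + b * R2 t) * v3))"
    and "Z' = (\<lambda>t. 2 * (R1 t * (R1 t + c * R3 t) * v1 + R3 t * (R3 t + c * R1 t) * v3))"
  have dX: "(X has_real_derivative X' t) (at t)" for t
    unfolding X_def X'_def by (auto intro!: derivative_eq_intros dR) (simp add: algebra_simps power2_eq_square)
  have dY: "(Y has_real_derivative Y' t) (at t)" for t
    unfolding Y_def Y'_def by (auto intro!: derivative_eq_intros dR) (simp add: algebra_simps power2_eq_square)
  have dZ: "(Z has_real_derivative Z' t) (at t)" for t
    unfolding Z_def Z'_def by (auto intro!: derivative_eq_intros dR) (simp add: algebra_simps power2_eq_square)
  have pos: "0 < X t" "0 < Y t" "0 < Z t" for t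
    unfolding X_def Y_def Z_def using eucl_square_pos R_pos gt by (meson le_less_trans zero_le_power2)+
  define n1 n2 n3 where "n1 = (\<lambda>t. (X t + Z t - Y t) / 2)" and "n2 = (\<lambda>t. (X t + Y t - Z t) / 2)"
    and "n3 = (\<lambda>t. (Z t + Y t - X t) / 2)"
  define \<Delta> where "\<Delta> = (\<lambda>t. X t * Z t - (n1 t)\<^sup>2)"
  have "v1 * clamped_angle (n1 1) (X 1 * Z 1) + v2 * clamped_angle (n2 1) (X 1 * Y 1)
      + v3 * clamped_angle (n3 1) (Z 1 * Y 1)
    < v1 * clamped_angle (n1 0) (X 0 * Z 0) + v2 * clamped_angle (n2 0) (X 0 * Y 0)
      + v3 * clamped_angle (n3 0) (Z 0 * Y 0)"
  proof (rule triangle_angles_monotone[OF dX dZ dY _ _ _ pos(1) pos(3) pos(2), where \<Delta> = \<Delta>])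
    fix t :: real
    show "(n1 has_real_derivative (X' t + Z' t - Y' t) / 2) (at t)"
      unfolding n1_def by (auto intro!: derivative_eq_intros dX dY dZ)
    show "(n2 has_real_derivative (X' t + Y' t - Z' t) / 2) (at t)"
      unfolding n2_def by (auto intro!: derivative_eq_intros dX dY dZ)
    show "(n3 has_real_derivative (Z' t + Y' t - X' t) / 2) (at t)"
      unfolding n3_def by (auto intro!: derivative_eq_intros dX dY dZ)
    show "X t * Z t - (n1 t)\<^sup>2 = \<Delta> t" "X t * Y t - (n2 t)\<^sup>2 = \<Delta> t" "Z t * Y t - (n3 t)\<^sup>2 = \<Delta> t"
      unfolding \<Delta>_def n1_def n2_def n3_def by (simp_all add: power2_eq_square field_simps)
    show "0 < \<Delta> 0" using nondegenerate by (simp add: \<Delta>_def n1_def X_def Y_def Z_def R_ends x y z)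
    assume "0 < \<Delta> t"
    define iX iY iZ where "iX = X' t / X t" and "iY = Y' t / Y t" and "iZ = Z' t / Z t"
    have i: "X t * iX = X' t" "Y t * iY = Y' t" "Z t * iZ = Z' t"
      using pos[of t] by (simp_all add: iX_def iY_def iZ_def)
    have n: "2 * n1 t = X t + Z t - Y t" "2 * n2 t = X t + Y t - Z t" "2 * n3 t = Z t + Y t - X t"
      by (simp_all add: n1_def n2_def n3_def)
    have v: "v1 \<noteq> v2 \<or> v2 \<noteq> v3" using ne by (simp only: v1_def v2_def v3_def)
    have "0 < v1 * (n2 t * X' t / X t - Y' t + n3 t * Z' t / Z t)
      + v2 * (n1 t * X' t / X t - Z' t + n3 t * Y' t / Y t)
      + v3 * (n1 t * Z' t / Z t - X' t + n2 t * Y' t / Y t)"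
    proof (rule eucl_angle_form_pos[OF R_pos(1)[of t] R_pos(2)[of t] R_pos(3)[of t] _ _ _ _ _ _ pos(1) pos(2) pos(3) _ _ _ _ v])
      show "0 < X t * Z t - (n1 t)\<^sup>2" using \<open>0 < \<Delta> t\<close> by (simp only: \<Delta>_def)
      show "n3 t = (Y t + Z t - X t) / 2" by (simp only: n3_def add.commute)
    qed (simp_all only: n1_def n2_def X_def Y_def Z_def X'_def Y'_def Z'_def mult.commute[of a] mult.commute[of b] mult.commute[of c] mult.assoc)
    then have "0 < v1 * (n2 t * iX - Y' t + n3 t * iZ) + v2 * (n1 t * iX - Z' t + n3 t * iY)
        + v3 * (n1 t * iZ - X' t + n2 t * iY)"
      unfolding iX_def iY_def iZ_def by (simp only: times_divide_eq_right)
    also have "\<dots> = v1 * (X' t + Z' t - Y' t - n1 t * (iX + iZ)) + v2 * (X' t + Y' t - Z' t - n2 t * (iX + iY))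
        + v3 * (Z' t + Y' t - X' t - n3 t * (iZ + iY))"
      using n unfolding i[symmetric] by algebra
    finally have pos_form: "0 < v1 * (X' t + Z' t - Y' t - n1 t * (iX + iZ)) + v2 * (X' t + Y' t - Z' t - n2 t * (iX + iY))
        + v3 * (Z' t + Y' t - X' t - n3 t * (iZ + iY))" .
    have halves: "0 < w1 * (A / 2 - m1 * A' / 2) + w2 * (B / 2 - m2 * B' / 2) + w3 * (C / 2 - m3 * C' / 2)"
      if "0 < w1 * (A - m1 * A') + w2 * (B - m2 * B') + w3 * (C - m3 * C')"
      for w1 w2 w3 A B C m1 m2 m3 A' B' C' :: real
      using that by (simp add: algebra_simps)
    show "0 < v1 * ((X' t + Z' t - Y' t) / 2 - n1 t * (X' t / X t + Z' t / Z t) / 2)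
        + v2 * ((X' t + Y' t - Z' t) / 2 - n2 t * (X' t / X t + Y' t / Y t) / 2)
        + v3 * ((Z' t + Y' t - X' t) / 2 - n3 t * (Z' t / Z t + Y' t / Y t) / 2)"
      by (rule halves) (use pos_form in \<open>simp only: iX_def iY_def iZ_def\<close>)
  qed
  moreover have "X 0 = x" "Y 0 = y" "Z 0 = z" "X 1 = x'" "Y 1 = y'" "Z 1 = z'"
    by (simp_all add: X_def Y_def Z_def R_ends x y z x' y' z')
  ultimately show ?thesis
    by (simp add: eucl_angle_of_squares_def n1_def n2_def n3_def v1_def v2_def v3_def)
qed

text \<open>The segment is taken in the coordinates \<open>u\<close>, which range over the negative numbers. They satisfy
  \<open>sinh r = - 1 / sinh u\<close> and \<open>cosh r = - cosh u / sinh u\<close>, so the derivatives of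
  \<open>cosh r\<close> and \<open>sinh r\<close> with respect to \<open>u\<close> are \<open>(sinh r)\<^sup>2\<close> and \<open>cosh r * sinh r\<close>.\<close>

lemma hyp_face_monotone:
  assumes r: "0 < r1" "0 < r2" "0 < r3" and s: "0 < s1" "0 < s2" "0 < s3"
    and x: "x = hyp_cosh a r1 r2" and y: "y = hyp_cosh b r2 r3" and z: "z = hyp_cosh c r1 r3"
    and x': "x' = hyp_cosh a s1 s2" and y': "y' = hyp_cosh b s2 s3" and z': "z' = hyp_cosh c s1 s3"
    and nondegenerate: "(x * z - y)\<^sup>2 < (x\<^sup>2 - 1) * (z\<^sup>2 - 1)"
    and u: "\<And>r. u r = - arsinh (1 / sinh r)"
    and ne: "u s1 \<noteq> u r1 \<or> u s2 \<noteq> u r2 \<or> u s3 \<noteq> u r3"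
  shows "(u s1 - u r1) * hyp_angle_of_cosh x' z' y' + (u s2 - u r2) * hyp_angle_of_cosh x' y' z'
      + (u s3 - u r3) * hyp_angle_of_cosh z' y' x'
    < (u s1 - u r1) * hyp_angle_of_cosh x z y + (u s2 - u r2) * hyp_angle_of_cosh x y z
      + (u s3 - u r3) * hyp_angle_of_cosh z y x"
proof -
  have u_neg: "u r < 0" if "0 < r" for r using that by (simp add: u)
  have sinh_u: "- (1 / sinh (u r)) = sinh r" for r by (simp add: u)
  have cosh_u: "- (cosh (u r) / sinh (u r)) = cosh r" if "0 < r" for r
  proof -
    have "(cosh (u r))\<^sup>2 = (cosh r / sinh r)\<^sup>2"
      using that cosh_square_eq[of r] by (simp add: cosh_square_eq[of "u r"]) (simp add: u field_simps power_divide)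
    then have "cosh (u r) = cosh r / sinh r" using that by (simp add: power2_eq_iff_nonneg)
    then show ?thesis using that by (simp add: u)
  qed
  define v1 v2 v3 where "v1 = u s1 - u r1" and "v2 = u s2 - u r2" and "v3 = u s3 - u r3"
  define U1 U2 U3 where "U1 = (\<lambda>t. u r1 + t * v1)" and "U2 = (\<lambda>t. u r2 + t * v2)"
    and "U3 = (\<lambda>t. u r3 + t * v3)"
  have seg: "p + t * (q - p) < 0" if "p < 0" "q < 0" "t \<in> {0..1}" for p q t :: real
  proof -
    have "(1 - t) * p + t * q < 0"
    proof (cases "t = 0")
      case False
      then have "t * q < 0" "(1 - t) * p \<le> 0" using that by (simp_all add: mult_less_0_iff mult_le_0_iff)
      then show ?thesis by linarith
    qed (use that in simp)
    then show ?thesis by (simp add: algebra_simps)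
  qed
  have U_neg: "U1 t < 0" "U2 t < 0" "U3 t < 0" if "t \<in> {0..1}" for t
    using seg[OF u_neg[OF r(1)] u_neg[OF s(1)] that] seg[OF u_neg[OF r(2)] u_neg[OF s(2)] that]
      seg[OF u_neg[OF r(3)] u_neg[OF s(3)] that]
    by (simp_all only: U1_def U2_def U3_def v1_def v2_def v3_def)
  define S1 S2 S3 where "S1 = (\<lambda>t. - (1 / sinh (U1 t)))" and "S2 = (\<lambda>t. - (1 / sinh (U2 t)))"
    and "S3 = (\<lambda>t. - (1 / sinh (U3 t)))"
  define C1 C2 C3 where "C1 = (\<lambda>t. - (cosh (U1 t) / sinh (U1 t)))" and "C2 = (\<lambda>t. - (cosh (U2 t) / sinh (U2 t)))"
    and "C3 = (\<lambda>t. - (cosh (U3 t) / sinh (U3 t)))"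
  have CS_ends: "S1 0 = sinh r1" "S2 0 = sinh r2" "S3 0 = sinh r3" "S1 1 = sinh s1" "S2 1 = sinh s2" "S3 1 = sinh s3"
    "C1 0 = cosh r1" "C2 0 = cosh r2" "C3 0 = cosh r3" "C1 1 = cosh s1" "C2 1 = cosh s2" "C3 1 = cosh s3"
    using sinh_u cosh_u r s unfolding S1_def S2_def S3_def C1_def C2_def C3_def U1_def U2_def U3_def v1_def v2_def v3_def
    by simp_all
  have CS_pos: "0 < - (1 / sinh w)" "0 < - (cosh w / sinh w)" if "w < 0" for w :: real
    using that by (simp_all add: divide_pos_neg)
  have CS_sq: "(- (cosh w / sinh w))\<^sup>2 = (- (1 / sinh w))\<^sup>2 + 1" if "w < 0" for w :: real
    using that by (simp add: power_divide cosh_square_eq add_divide_distrib)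
  have S_pos: "0 < S1 t" "0 < S2 t" "0 < S3 t" and C_pos: "0 < C1 t" "0 < C2 t" "0 < C3 t"
    and CS: "(C1 t)\<^sup>2 = (S1 t)\<^sup>2 + 1" "(C2 t)\<^sup>2 = (S2 t)\<^sup>2 + 1" "(C3 t)\<^sup>2 = (S3 t)\<^sup>2 + 1" if "t \<in> {0..1}" for t
    using U_neg[OF that, THEN CS_pos(1)] U_neg[OF that, THEN CS_pos(2)] U_neg[OF that, THEN CS_sq]
    by (simp_all only: S1_def S2_def S3_def C1_def C2_def C3_def)
  have dS: "((\<lambda>t. - (1 / sinh (p + t * v))) has_real_derivative
      - (cosh (p + t * v) / sinh (p + t * v)) * (- (1 / sinh (p + t * v))) * v) (at t)"
    and dC: "((\<lambda>t. - (cosh (p + t * v) / sinh (p + t * v))) has_real_derivative (- (1 / sinh (p + t * v)))\<^sup>2 * v) (at t)"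
    if "p + t * v < 0" for p v t :: real
  proof -
    have nz: "sinh (p + t * v) \<noteq> 0" using that by simp
    have ds: "((\<lambda>t. sinh (p + t * v)) has_real_derivative cosh (p + t * v) * v) (at t)"
      and dc: "((\<lambda>t. cosh (p + t * v)) has_real_derivative sinh (p + t * v) * v) (at t)"
      by (auto intro!: derivative_eq_intros)
    show "((\<lambda>t. - (1 / sinh (p + t * v))) has_real_derivative
      - (cosh (p + t * v) / sinh (p + t * v)) * (- (1 / sinh (p + t * v))) * v) (at t)"
      using DERIV_minus[OF DERIV_divide[OF DERIV_const[of 1] ds nz]] by simp
    have "- ((sinh (p + t * v) * v * sinh (p + t * v) - cosh (p + t * v) * (cosh (p + t * v) * v))
        / (sinh (p + t * v) * sinh (p + t * v))) = (- (1 / sinh (p + t * v)))\<^sup>2 * v"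
    proof -
      have "sinh (p + t * v) * v * sinh (p + t * v) - cosh (p + t * v) * (cosh (p + t * v) * v) = - v"
        using cosh_square_eq[of "p + t * v"] by algebra
      then show ?thesis by (simp add: power2_eq_square)
    qed
    then show "((\<lambda>t. - (cosh (p + t * v) / sinh (p + t * v))) has_real_derivative (- (1 / sinh (p + t * v)))\<^sup>2 * v) (at t)"
      using DERIV_minus[OF DERIV_divide[OF dc ds nz]] by simp
  qed
  have dS1: "(S1 has_real_derivative C1 t * S1 t * v1) (at t)" and dS2: "(S2 has_real_derivative C2 t * S2 t * v2) (at t)"
    and dS3: "(S3 has_real_derivative C3 t * S3 t * v3) (at t)"
    and dC1: "(C1 has_real_derivative (S1 t)\<^sup>2 * v1) (at t)" and dC2: "(C2 has_real_derivative (S2 t)\<^sup>2 * v2) (at t)"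
    and dC3: "(C3 has_real_derivative (S3 t)\<^sup>2 * v3) (at t)" if "t \<in> {0..1}" for t
    using U_neg[OF that, unfolded U1_def U2_def U3_def, THEN dS] U_neg[OF that, unfolded U1_def U2_def U3_def, THEN dC]
    by (simp_all only: S1_def S2_def S3_def C1_def C2_def C3_def U1_def U2_def U3_def)
  define X Y Z where "X = (\<lambda>t. C1 t * C2 t + a * S1 t * S2 t)" and "Y = (\<lambda>t. C2 t * C3 t + b * S2 t * S3 t)"
    and "Z = (\<lambda>t. C1 t * C3 t + c * S1 t * S3 t)"
  define X' Y' Z' where "X' = (\<lambda>t. (C1 t * X t - C2 t) * v1 + (C2 t * X t - C1 t) * v2)"
    and "Y' = (\<lambda>t. (C2 t * Y t - C3 t) * v2 + (C3 t * Y t - C2 t) * v3)"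
    and "Z' = (\<lambda>t. (C1 t * Z t - C3 t) * v1 + (C3 t * Z t - C1 t) * v3)"
  have dX: "(X has_real_derivative X' t) (at t)" if "t \<in> {0..1}" for t
  proof -
    have "(X has_real_derivative (S1 t)\<^sup>2 * v1 * C2 t + (S2 t)\<^sup>2 * v2 * C1 t
        + (a * (C1 t * S1 t * v1) * S2 t + C2 t * S2 t * v2 * (a * S1 t))) (at t)"
      unfolding X_def using that by (intro DERIV_add DERIV_mult DERIV_cmult dS1 dS2 dC1 dC2)
    also have "(S1 t)\<^sup>2 * v1 * C2 t + (S2 t)\<^sup>2 * v2 * C1 t
        + (a * (C1 t * S1 t * v1) * S2 t + C2 t * S2 t * v2 * (a * S1 t)) = X' t"
      unfolding X'_def X_def using CS[OF that] by algebra
    finally show ?thesis .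
  qed
  have dY: "(Y has_real_derivative Y' t) (at t)" if "t \<in> {0..1}" for t
  proof -
    have "(Y has_real_derivative (S2 t)\<^sup>2 * v2 * C3 t + (S3 t)\<^sup>2 * v3 * C2 t
        + (b * (C2 t * S2 t * v2) * S3 t + C3 t * S3 t * v3 * (b * S2 t))) (at t)"
      unfolding Y_def using that by (intro DERIV_add DERIV_mult DERIV_cmult dS2 dS3 dC2 dC3)
    also have "(S2 t)\<^sup>2 * v2 * C3 t + (S3 t)\<^sup>2 * v3 * C2 t
        + (b * (C2 t * S2 t * v2) * S3 t + C3 t * S3 t * v3 * (b * S2 t)) = Y' t"
      unfolding Y'_def Y_def using CS[OF that] by algebra
    finally show ?thesis .
  qed
  have dZ: "(Z has_real_derivative Z' t) (at t)" if "t \<in> {0..1}" for t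
  proof -
    have "(Z has_real_derivative (S1 t)\<^sup>2 * v1 * C3 t + (S3 t)\<^sup>2 * v3 * C1 t
        + (c * (C1 t * S1 t * v1) * S3 t + C3 t * S3 t * v3 * (c * S1 t))) (at t)"
      unfolding Z_def using that by (intro DERIV_add DERIV_mult DERIV_cmult dS1 dS3 dC1 dC3)
    also have "(S1 t)\<^sup>2 * v1 * C3 t + (S3 t)\<^sup>2 * v3 * C1 t
        + (c * (C1 t * S1 t * v1) * S3 t + C3 t * S3 t * v3 * (c * S1 t)) = Z' t"
      unfolding Z'_def Z_def using CS[OF that] by algebra
    finally show ?thesis .
  qed
  have gt1: "1 < p * q + e * k * l"
    if "0 < k" "0 < l" "0 < p" "0 < q" "p\<^sup>2 = k\<^sup>2 + 1" "q\<^sup>2 = l\<^sup>2 + 1" "-1 < e" for p q e k l :: real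
  proof -
    have "(p * q)\<^sup>2 = (1 + k * l)\<^sup>2 + (k - l)\<^sup>2" using that(5,6) by algebra
    then have "(1 + k * l)\<^sup>2 \<le> (p * q)\<^sup>2" by simp
    then have "1 + k * l \<le> p * q" by (rule power2_le_imp_le) (use that in simp)
    moreover have "0 < k * l * (1 + e)" using that by simp
    ultimately show ?thesis by (simp add: algebra_simps)
  qed
  have XYZ: "1 < X t" "1 < Y t" "1 < Z t" if "t \<in> {0..1}" for t
    using gt1[OF S_pos(1,2)[OF that] C_pos(1,2)[OF that] CS(1,2)[OF that] gt(1)]
      gt1[OF S_pos(2,3)[OF that] C_pos(2,3)[OF that] CS(2,3)[OF that] gt(2)]
      gt1[OF S_pos(1,3)[OF that] C_pos(1,3)[OF that] CS(1,3)[OF that] gt(3)]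
    by (simp_all only: X_def Y_def Z_def)
  then have pos: "0 < (X t)\<^sup>2 - 1" "0 < (Y t)\<^sup>2 - 1" "0 < (Z t)\<^sup>2 - 1" if "t \<in> {0..1}" for t
    using that by simp_all
  define n1 n2 n3 where "n1 = (\<lambda>t. X t * Z t - Y t)" and "n2 = (\<lambda>t. X t * Y t - Z t)"
    and "n3 = (\<lambda>t. Z t * Y t - X t)"
  define \<Delta> where "\<Delta> = (\<lambda>t. ((X t)\<^sup>2 - 1) * ((Z t)\<^sup>2 - 1) - (n1 t)\<^sup>2)"
  have "v1 * clamped_angle (n1 1) (((X 1)\<^sup>2 - 1) * ((Z 1)\<^sup>2 - 1)) + v2 * clamped_angle (n2 1) (((X 1)\<^sup>2 - 1) * ((Y 1)\<^sup>2 - 1))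
      + v3 * clamped_angle (n3 1) (((Z 1)\<^sup>2 - 1) * ((Y 1)\<^sup>2 - 1))
    < v1 * clamped_angle (n1 0) (((X 0)\<^sup>2 - 1) * ((Z 0)\<^sup>2 - 1)) + v2 * clamped_angle (n2 0) (((X 0)\<^sup>2 - 1) * ((Y 0)\<^sup>2 - 1))
      + v3 * clamped_angle (n3 0) (((Z 0)\<^sup>2 - 1) * ((Y 0)\<^sup>2 - 1))"
  proof (rule triangle_angles_monotone[where \<Delta> = \<Delta>])
    fix t :: real
    show "((X t)\<^sup>2 - 1) * ((Z t)\<^sup>2 - 1) - (n1 t)\<^sup>2 = \<Delta> t" "((X t)\<^sup>2 - 1) * ((Y t)\<^sup>2 - 1) - (n2 t)\<^sup>2 = \<Delta> t"
      "((Z t)\<^sup>2 - 1) * ((Y t)\<^sup>2 - 1) - (n3 t)\<^sup>2 = \<Delta> t"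
      unfolding \<Delta>_def n1_def n2_def n3_def by algebra+
    show "0 < \<Delta> 0" using nondegenerate by (simp add: \<Delta>_def n1_def X_def Y_def Z_def CS_ends x y z)
    assume t: "t \<in> {0..1}"
    show "((\<lambda>t. (X t)\<^sup>2 - 1) has_real_derivative 2 * X t * X' t) (at t)"
      "((\<lambda>t. (Y t)\<^sup>2 - 1) has_real_derivative 2 * Y t * Y' t) (at t)"
      "((\<lambda>t. (Z t)\<^sup>2 - 1) has_real_derivative 2 * Z t * Z' t) (at t)"
      by (auto intro!: derivative_eq_intros dX dY dZ t)
    show "(n1 has_real_derivative X' t * Z t + Z' t * X t - Y' t) (at t)"
      "(n2 has_real_derivative X' t * Y t + Y' t * X t - Z' t) (at t)"
      "(n3 has_real_derivative Z' t * Y t + Y' t * Z t - X' t) (at t)"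
      unfolding n1_def n2_def n3_def by (intro DERIV_diff DERIV_mult dX dY dZ t)+
    show "0 < (X t)\<^sup>2 - 1" "0 < (Z t)\<^sup>2 - 1" "0 < (Y t)\<^sup>2 - 1" using pos[OF t] by simp_all
    assume "0 < \<Delta> t"
    then have D: "0 < 1 + 2 * X t * Y t * Z t - (X t)\<^sup>2 - (Y t)\<^sup>2 - (Z t)\<^sup>2"
      unfolding \<Delta>_def n1_def by (simp add: power2_eq_square algebra_simps)
    have v: "v1 \<noteq> 0 \<or> v2 \<noteq> 0 \<or> v3 \<noteq> 0" using ne by (simp add: v1_def v2_def v3_def)
    define iX iY iZ where "iX = X' t / ((X t)\<^sup>2 - 1)" and "iY = Y' t / ((Y t)\<^sup>2 - 1)" and "iZ = Z' t / ((Z t)\<^sup>2 - 1)"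
    have i: "((X t)\<^sup>2 - 1) * iX = X' t" "((Y t)\<^sup>2 - 1) * iY = Y' t" "((Z t)\<^sup>2 - 1) * iZ = Z' t"
      using pos[OF t] by (simp_all add: iX_def iY_def iZ_def)
    have "0 < v1 * ((X t * Y t - Z t) * X' t / ((X t)\<^sup>2 - 1) - Y' t + (Y t * Z t - X t) * Z' t / ((Z t)\<^sup>2 - 1))
      + v2 * ((X t * Z t - Y t) * X' t / ((X t)\<^sup>2 - 1) - Z' t + (Y t * Z t - X t) * Y' t / ((Y t)\<^sup>2 - 1))
      + v3 * ((X t * Z t - Y t) * Z' t / ((Z t)\<^sup>2 - 1) - X' t + (X t * Y t - Z t) * Y' t / ((Y t)\<^sup>2 - 1))"
      by (rule hyp_angle_form_pos[OF C_pos[OF t] S_pos[OF t] CS[OF t] _ _ _ XYZ[OF t] D _ _ _ v])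
         (simp_all only: X_def Y_def Z_def X'_def Y'_def Z'_def)
    then have "0 < v1 * ((X t * Y t - Z t) * iX - Y' t + (Y t * Z t - X t) * iZ)
      + v2 * ((X t * Z t - Y t) * iX - Z' t + (Y t * Z t - X t) * iY)
      + v3 * ((X t * Z t - Y t) * iZ - X' t + (X t * Y t - Z t) * iY)"
      unfolding iX_def iY_def iZ_def by (simp only: times_divide_eq_right)
    also have "\<dots> = v1 * (X' t * Z t + Z' t * X t - Y' t - n1 t * (X t * iX + Z t * iZ))
        + v2 * (X' t * Y t + Y' t * X t - Z' t - n2 t * (X t * iX + Y t * iY))
        + v3 * (Z' t * Y t + Y' t * Z t - X' t - n3 t * (Z t * iZ + Y t * iY))"
      unfolding n1_def n2_def n3_def i[symmetric] by algebra
    finally have pos_form: "0 < v1 * (X' t * Z t + Z' t * X t - Y' t - n1 t * (X t * iX + Z t * iZ))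
        + v2 * (X' t * Y t + Y' t * X t - Z' t - n2 t * (X t * iX + Y t * iY))
        + v3 * (Z' t * Y t + Y' t * Z t - X' t - n3 t * (Z t * iZ + Y t * iY))" .
    \<comment> \<open>The derivative of \<open>(X t)\<^sup>2 - 1\<close> brings the factor 2 that cancels against the \<open>/ 2\<close>.\<close>
    have half: "n * (2 * A * B / P + 2 * E * G / Q) / 2 = n * (A * (B / P) + E * (G / Q))" for n A B P E G Q :: real
      by (simp add: algebra_simps)
    show "0 < v1 * (X' t * Z t + Z' t * X t - Y' t
          - n1 t * (2 * X t * X' t / ((X t)\<^sup>2 - 1) + 2 * Z t * Z' t / ((Z t)\<^sup>2 - 1)) / 2)
        + v2 * (X' t * Y t + Y' t * X t - Z' t
          - n2 t * (2 * X t * X' t / ((X t)\<^sup>2 - 1) + 2 * Y t * Y' t / ((Y t)\<^sup>2 - 1)) / 2)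
        + v3 * (Z' t * Y t + Y' t * Z t - X' t
          - n3 t * (2 * Z t * Z' t / ((Z t)\<^sup>2 - 1) + 2 * Y t * Y' t / ((Y t)\<^sup>2 - 1)) / 2)"
      using pos_form unfolding half iX_def iY_def iZ_def .
  qed
  moreover have "X 0 = x" "Y 0 = y" "Z 0 = z" "X 1 = x'" "Y 1 = y'" "Z 1 = z'"
    by (simp_all add: X_def Y_def Z_def CS_ends x y z x' y' z')
  ultimately show ?thesis
    by (simp add: hyp_angle_of_cosh_def n1_def n2_def n3_def v1_def v2_def v3_def)
qed

end

section \<open>Realizing faces in the two planes\<close>

text \<open>To evaluate the definite description, it is enough to have one realization of the triangle, and to know the angle in all realizations.
  The angle has to be known for both orders of the other two vertices, as the order is not part of
  the definition.\<close>

lemma inner_angle_eqI: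
  assumes f: "f = {i, j, k}" and distinct: "i \<noteq> j" "i \<noteq> k" "j \<noteq> k"
    and d_commute: "\<And>p q. d p q = d q p" and l_commute: "\<And>u v. l u v = l v u"
    and ex: "p0 \<in> X" "q0 \<in> X" "r0 \<in> X" "d p0 q0 = l i j" "d p0 r0 = l i k" "d q0 r0 = l j k"
    and ang: "\<And>p q r. p \<in> X \<Longrightarrow> q \<in> X \<Longrightarrow> r \<in> X \<Longrightarrow> d p q = l i j \<Longrightarrow> d p r = l i k \<Longrightarrow> d q r = l j k
      \<Longrightarrow> ang p q r = \<theta> \<and> ang p r q = \<theta>"
  shows "inner_angle X d ang l f i = \<theta>"
  unfolding inner_angle_def
proof (rule the_equality)
  define P where "P = (\<lambda>v. if v = i then p0 else if v = j then q0 else r0)"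
  have P: "P i = p0" "P j = q0" "P k = r0" using distinct by (auto simp: P_def)
  have "\<forall>u\<in>f. \<forall>v\<in>f. u \<noteq> v \<longrightarrow> d (P u) (P v) = l u v"
    using ex d_commute l_commute unfolding f by (auto simp: P)
  moreover have "P ` f \<subseteq> X" using ex unfolding f by (auto simp: P)
  moreover have "ang (P i) (P j) (P k) = \<theta>" using ang ex unfolding P by blast
  ultimately show "\<exists>P j k. f = {i, j, k} \<and> P ` f \<subseteq> X \<and>
      (\<forall>u\<in>f. \<forall>v\<in>f. u \<noteq> v \<longrightarrow> d (P u) (P v) = l u v) \<and> \<theta> = ang (P i) (P j) (P k)"
    using f by (intro exI[of _ P] exI[of _ j] exI[of _ k]) auto
next
  fix \<phi>
  assume "\<exists>P j k. f = {i, j, k} \<and> P ` f \<subseteq> X \<and>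
      (\<forall>u\<in>f. \<forall>v\<in>f. u \<noteq> v \<longrightarrow> d (P u) (P v) = l u v) \<and> \<phi> = ang (P i) (P j) (P k)"
  then obtain P j' k' where P: "f = {i, j', k'}" "P ` f \<subseteq> X" "\<forall>u\<in>f. \<forall>v\<in>f. u \<noteq> v \<longrightarrow> d (P u) (P v) = l u v"
    and \<phi>: "\<phi> = ang (P i) (P j') (P k')" by blast
  have "(j' = j \<and> k' = k) \<or> (j' = k \<and> k' = j)" using P(1) f distinct by auto
  moreover have "ang (P i) (P j) (P k) = \<theta> \<and> ang (P i) (P k) (P j) = \<theta>"
    using P(2,3) distinct unfolding f by (intro ang) auto
  ultimately show "\<phi> = \<theta>" using \<phi> by auto
qed

lemma eucl_angle_eq:
  assumes d: "dist p q = sqrt x" "dist p r = sqrt z" "dist q r = sqrt y"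
    and pos: "0 < x" "0 < y" "0 < z" and nondeg: "((x + z - y) / 2)\<^sup>2 < x * z"
  shows "eucl_angle p q r = eucl_angle_of_squares x z y"
proof -
  have n: "norm (q - p) = sqrt x" "norm (r - p) = sqrt z" "norm ((q - p) - (r - p)) = sqrt y"
    using d by (simp_all add: dist_norm norm_minus_commute)
  have "(q - p) \<bullet> (r - p) = ((norm (q - p))\<^sup>2 + (norm (r - p))\<^sup>2 - (norm ((q - p) - (r - p)))\<^sup>2) / 2"
    by (rule dot_norm_neg)
  also have "\<dots> = (x + z - y) / 2" unfolding n using pos by simp
  finally have inner: "(q - p) \<bullet> (r - p) = (x + z - y) / 2" .
  show ?thesis
    unfolding eucl_angle_def eucl_angle_of_squares_def clamped_angle_eq(1)[OF nondeg] n inner real_sqrt_mult ..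
qed

text \<open>The first edge is placed on the first coordinate axis, with \<open>p\<close> at the origin.\<close>

lemma eucl_triangle_exists:
  fixes x y z :: real
  assumes pos: "0 < x" "0 < y" "0 < z" and nondeg: "((x + z - y) / 2)\<^sup>2 < x * z"
  obtains p q r :: "real^2" where "dist p q = sqrt x" "dist p r = sqrt z" "dist q r = sqrt y"
proof -
  define n where "n = (x + z - y) / 2"
  define h where "h = sqrt (x * z - n\<^sup>2)"
  have h2: "h\<^sup>2 = x * z - n\<^sup>2" using nondeg by (simp add: h_def n_def)
  have sx: "(sqrt x)\<^sup>2 = x" "sqrt x \<noteq> 0" using pos by simp_all
  define p q r :: "real^2" where "p = 0" and "q = vector [sqrt x, 0]" and "r = vector [n / sqrt x, h / sqrt x]"
  have sq: "(dist v w)\<^sup>2 = (v $ 1 - w $ 1)\<^sup>2 + (v $ 2 - w $ 2)\<^sup>2" for v w :: "real^2"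
    unfolding dist_norm power2_norm_eq_inner by (simp add: inner_vec_def sum_2 power2_eq_square)
  have "(dist p q)\<^sup>2 = x" using pos unfolding sq by (simp add: p_def q_def)
  moreover have pr: "(n / sqrt x)\<^sup>2 + (h / sqrt x)\<^sup>2 = z"
    using pos by (simp add: power_divide h2 add_divide_distrib[symmetric])
  then have "(dist p r)\<^sup>2 = z" unfolding sq by (simp add: p_def r_def)
  moreover have "(dist q r)\<^sup>2 = y"
  proof -
    have "sqrt x * (n / sqrt x) = n" using sx by simp
    then have "(sqrt x - n / sqrt x)\<^sup>2 + (h / sqrt x)\<^sup>2 = x - 2 * n + ((n / sqrt x)\<^sup>2 + (h / sqrt x)\<^sup>2)"
      using sx by (simp add: power2_diff mult.assoc)
    also have "\<dots> = y" unfolding pr by (simp add: n_def field_simps)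
    finally show ?thesis unfolding sq by (simp add: q_def r_def)
  qed
  ultimately show ?thesis using that[of p q r] by (simp add: real_sqrt_unique)
qed

lemma lorentz_commute: "lorentz p q = lorentz q p"
  by (simp add: lorentz_def inner_commute mult.commute)

lemma hyp_dist_commute: "hyp_dist p q = hyp_dist q p"
  by (simp add: hyp_dist_def lorentz_commute)

text \<open>The reversed Cauchy-Schwarz inequality on the hyperboloid, which makes \<open>arcosh\<close> injective on all values of \<open>- lorentz p q\<close>.\<close>

lemma lorentz_le_minus_1:
  assumes "p \<in> hyp_plane" "q \<in> hyp_plane"
  shows "lorentz p q \<le> -1"
proof -
  define \<alpha> \<beta> where "\<alpha> = norm (fst p)" and "\<beta> = norm (fst q)"
  have s: "(snd p)\<^sup>2 = 1 + \<alpha>\<^sup>2" "(snd q)\<^sup>2 = 1 + \<beta>\<^sup>2" "0 < snd p" "0 < snd q"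
    using assms by (auto simp: hyp_plane_def lorentz_def \<alpha>_def \<beta>_def power2_norm_eq_inner power2_eq_square[of "snd _"])
  have "(1 + \<alpha> * \<beta>)\<^sup>2 \<le> (snd p * snd q)\<^sup>2"
    using zero_le_power2[of "\<alpha> - \<beta>"] unfolding power_mult_distrib s by (simp add: power2_eq_square algebra_simps)
  then have "1 + \<alpha> * \<beta> \<le> snd p * snd q" by (rule power2_le_imp_le) (use s in simp)
  moreover have "fst p \<bullet> fst q \<le> \<alpha> * \<beta>" unfolding \<alpha>_def \<beta>_def by (rule norm_cauchy_schwarz)
  ultimately show ?thesis by (simp add: lorentz_def)
qed

lemma lorentz_of_hyp_dist:
  assumes "p \<in> hyp_plane" "q \<in> hyp_plane" "hyp_dist p q = arcosh x" "1 \<le> x"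
  shows "lorentz p q = - x"
proof -
  have "cosh (hyp_dist p q) = - lorentz p q"
    using lorentz_le_minus_1[OF assms(1,2)] by (simp add: hyp_dist_def)
  then show ?thesis using assms(3,4) by simp
qed

lemma hyp_angle_eq:
  assumes in_plane: "p \<in> hyp_plane" "q \<in> hyp_plane" "r \<in> hyp_plane"
    and d: "hyp_dist p q = arcosh x" "hyp_dist p r = arcosh z" "hyp_dist q r = arcosh y"
    and gt1: "1 < x" "1 < y" "1 < z" and nondeg: "(x * z - y)\<^sup>2 < (x\<^sup>2 - 1) * (z\<^sup>2 - 1)"
  shows "hyp_angle p q r = hyp_angle_of_cosh x z y"
proof -
  have L: "lorentz p q = - x" "lorentz p r = - z" "lorentz q r = - y"
    using lorentz_of_hyp_dist in_plane d gt1 by (simp_all add: less_imp_le)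
  have L1: "lorentz p p = -1" "lorentz q q = -1" "lorentz r r = -1" using in_plane by (simp_all add: hyp_plane_def)
  have exp: "lorentz (v + s *\<^sub>R p) (w + t *\<^sub>R p) = lorentz v w + t * lorentz p v + s * lorentz p w + s * t * lorentz p p" for v w s t
    by (simp add: lorentz_def inner_add inner_commute algebra_simps)
  have "lorentz (hyp_direction p q) (hyp_direction p r) = x * z - y"
    "lorentz (hyp_direction p q) (hyp_direction p q) = x\<^sup>2 - 1"
    "lorentz (hyp_direction p r) (hyp_direction p r) = z\<^sup>2 - 1"
    unfolding hyp_direction_def exp L L1 by (simp_all add: power2_eq_square)
  then show ?thesis
    using clamped_angle_eq(1)[OF nondeg]
    by (simp add: hyp_angle_def Let_def hyp_angle_of_cosh_def real_sqrt_mult)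
qed

text \<open>The apex \<open>p\<close> is the lowest point of the hyperboloid; the tangential parts of \<open>q\<close> and \<open>r\<close> are placed as in the Euclidean case.\<close>

lemma hyp_triangle_exists:
  fixes x y z :: real
  assumes gt1: "1 < x" "1 < y" "1 < z" and nondeg: "(x * z - y)\<^sup>2 < (x\<^sup>2 - 1) * (z\<^sup>2 - 1)"
  obtains p q r where "p \<in> hyp_plane" "q \<in> hyp_plane" "r \<in> hyp_plane"
    "hyp_dist p q = arcosh x" "hyp_dist p r = arcosh z" "hyp_dist q r = arcosh y"
proof -
  define X where "X = x\<^sup>2 - 1"
  define n where "n = x * z - y"
  define h where "h = sqrt (X * (z\<^sup>2 - 1) - n\<^sup>2)"
  have X: "0 < X" using gt1 by (simp add: X_def)
  have h2: "h\<^sup>2 = X * (z\<^sup>2 - 1) - n\<^sup>2" using nondeg by (simp add: h_def n_def X_def)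
  define p q r :: "(real^2) \<times> real" where "p = (0, 1)" and "q = (vector [sqrt X, 0], x)"
    and "r = (vector [n / sqrt X, h / sqrt X], z)"
  have lor: "lorentz v w = fst v $ 1 * fst w $ 1 + fst v $ 2 * fst w $ 2 - snd v * snd w" for v w
    by (simp add: lorentz_def inner_vec_def sum_2)
  have "n / sqrt X * (n / sqrt X) + h / sqrt X * (h / sqrt X) = (n\<^sup>2 + h\<^sup>2) / X"
    using X by (simp add: add_divide_distrib power2_eq_square)
  also have "\<dots> = z\<^sup>2 - 1" unfolding h2 using X by simp
  finally have rr: "lorentz r r = -1" unfolding lor by (simp add: r_def power2_eq_square)
  have qq: "lorentz q q = -1" unfolding lor using X by (simp add: q_def X_def power2_eq_square)
  have "lorentz p q = - x" "lorentz p r = - z" unfolding lor by (simp_all add: p_def q_def r_def)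
  moreover have "lorentz q r = - y" unfolding lor using X by (simp add: q_def r_def n_def)
  moreover have "p \<in> hyp_plane" "q \<in> hyp_plane" "r \<in> hyp_plane"
    using rr qq gt1 by (simp_all add: hyp_plane_def lor) (simp_all add: p_def q_def r_def)
  ultimately show ?thesis using that[of p q r] by (simp add: hyp_dist_def)
qed

text \<open>Heron's formula: the difference of the two sides is a product of the four positive factors \<open>A + B + C\<close>, \<open>A + B - C\<close>, \<open>A - B + C\<close>, \<open>B + C - A\<close>, up to a constant.\<close>

lemma eucl_nondegenerate:
  assumes pos: "0 < x" "0 < y" "0 < z"
    and tri: "sqrt x < sqrt z + sqrt y" "sqrt z < sqrt x + sqrt y" "sqrt y < sqrt x + sqrt z"
  shows "((x + z - y) / 2)\<^sup>2 < x * z"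
proof -
  define A B C where "A = sqrt x" and "B = sqrt z" and "C = sqrt y"
  have sq: "x = A\<^sup>2" "z = B\<^sup>2" "y = C\<^sup>2" and p: "0 < A" "0 < B" "0 < C" using pos by (simp_all add: A_def B_def C_def)
  have "0 < (A + B + C) * (A + B - C) * (A - B + C) * (B + C - A)"
    using tri p unfolding A_def[symmetric] B_def[symmetric] C_def[symmetric] by (intro mult_pos_pos) linarith+
  also have "\<dots> = 4 * (x * z - ((x + z - y) / 2)\<^sup>2)"
  proof -
    have "(A + B + C) * (A + B - C) * (A - B + C) * (B + C - A) = 4 * (x * z) - (x + z - y)\<^sup>2"
      unfolding sq by algebra
    then show ?thesis by (simp add: power_divide)
  qed
  finally show ?thesis by simp
qed

text \<open>The triangle inequalities say that \<open>y\<close> lies strictly between \<open>cosh (A - B)\<close> and \<open>cosh (A + B)\<close>, to which the addition theorems apply.\<close>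

lemma hyp_nondegenerate:
  fixes x y z :: real
  assumes gt1: "1 < x" "1 < y" "1 < z"
    and tri: "arcosh x < arcosh z + arcosh y" "arcosh z < arcosh x + arcosh y" "arcosh y < arcosh x + arcosh z"
  shows "(x * z - y)\<^sup>2 < (x\<^sup>2 - 1) * (z\<^sup>2 - 1)"
proof -
  define A B C where "A = arcosh x" and "B = arcosh z" and "C = arcosh y"
  have c: "cosh A = x" "cosh B = z" "cosh C = y" and p: "0 < A" "0 < B" "0 < C"
    using gt1 by (simp_all add: A_def B_def C_def)
  have "cosh C < cosh (A + B)"
    using p tri unfolding A_def[symmetric] B_def[symmetric] C_def[symmetric] by (simp add: cosh_real_nonneg_less_iff)
  then have 1: "y - x * z < sinh A * sinh B" by (simp add: cosh_add c)
  have "cosh \<bar>A - B\<bar> < cosh C"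
    using p tri unfolding A_def[symmetric] B_def[symmetric] C_def[symmetric]
    by (subst cosh_real_nonneg_less_iff) auto
  then have 2: "x * z - y < sinh A * sinh B" by (simp add: cosh_diff c)
  have "\<bar>x * z - y\<bar> < \<bar>sinh A * sinh B\<bar>" using 1 2 by linarith
  then have "(x * z - y)\<^sup>2 < (sinh A * sinh B)\<^sup>2" using power_strict_mono[of "\<bar>x * z - y\<bar>" "\<bar>sinh A * sinh B\<bar>" 2] by simp
  also have "\<dots> = (x\<^sup>2 - 1) * (z\<^sup>2 - 1)" by (simp add: power_mult_distrib sinh_square_eq c)
  finally show ?thesis .
qed

lemma eucl_length_eq: "eucl_length I r i j = sqrt (eucl_square (I {i, j}) (r i) (r j))"
  by (simp add: eucl_length_def)

lemma hyp_length_eq: "hyp_length I r i j = arcosh (hyp_cosh (I {i, j}) (r i) (r j))"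
  by (simp add: hyp_length_def)

lemma eucl_inner_angle:
  assumes distinct: "i \<noteq> j" "i \<noteq> k" "j \<noteq> k"
    and pos: "0 < r i" "0 < r j" "0 < r k" and I: "-1 < I {i, j}" "-1 < I {i, k}" "-1 < I {j, k}"
    and x: "x = eucl_square (I {i, j}) (r i) (r j)" and z: "z = eucl_square (I {i, k}) (r i) (r k)"
    and y: "y = eucl_square (I {j, k}) (r j) (r k)"
    and nondeg: "((x + z - y) / 2)\<^sup>2 < x * z"
  shows "inner_angle UNIV dist eucl_angle (eucl_length I r) {i, j, k} i = eucl_angle_of_squares x z y"
proof -
  have xyz: "0 < x" "0 < y" "0 < z" unfolding x y z
    using eucl_square_pos pos I by (meson le_less_trans zero_le_power2)+
  obtain p q s :: "real^2" where pqs: "dist p q = sqrt x" "dist p s = sqrt z" "dist q s = sqrt y"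
    using eucl_triangle_exists[OF xyz nondeg] .
  have nondeg': "((z + x - y) / 2)\<^sup>2 < z * x" using nondeg by (simp add: add_ac mult.commute)
  have sym: "eucl_angle_of_squares z x y = eucl_angle_of_squares x z y"
    by (simp add: eucl_angle_of_squares_def add_ac mult.commute)
  show ?thesis
  proof (rule inner_angle_eqI[OF refl distinct dist_commute])
    show "eucl_length I r u v = eucl_length I r v u" for u v
      by (simp add: eucl_length_def insert_commute mult_ac add_ac)
    show "dist p q = eucl_length I r i j" "dist p s = eucl_length I r i k" "dist q s = eucl_length I r j k"
      unfolding eucl_length_eq pqs x y z by (rule refl)+
    fix p' q' s' :: "real^2"
    assume "dist p' q' = eucl_length I r i j" "dist p' s' = eucl_length I r i k" "dist q' s' = eucl_length I r j k"
    then have d: "dist p' q' = sqrt x" "dist p' s' = sqrt z" "dist q' s' = sqrt y"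
      unfolding eucl_length_eq x y z by auto
    show "eucl_angle p' q' s' = eucl_angle_of_squares x z y \<and> eucl_angle p' s' q' = eucl_angle_of_squares x z y"
      using eucl_angle_eq[OF d xyz nondeg] eucl_angle_eq[OF d(2) d(1) _ xyz(3,2,1) nondeg'] d(3) sym
      by (simp add: dist_commute)
  qed auto
qed

lemma hyp_inner_angle:
  assumes distinct: "i \<noteq> j" "i \<noteq> k" "j \<noteq> k"
    and pos: "0 < r i" "0 < r j" "0 < r k" and I: "-1 < I {i, j}" "-1 < I {i, k}" "-1 < I {j, k}"
    and x: "x = hyp_cosh (I {i, j}) (r i) (r j)" and z: "z = hyp_cosh (I {i, k}) (r i) (r k)"
    and y: "y = hyp_cosh (I {j, k}) (r j) (r k)"
    and nondeg: "(x * z - y)\<^sup>2 < (x\<^sup>2 - 1) * (z\<^sup>2 - 1)"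
  shows "inner_angle hyp_plane hyp_dist hyp_angle (hyp_length I r) {i, j, k} i = hyp_angle_of_cosh x z y"
proof -
  have xyz: "1 < x" "1 < y" "1 < z" unfolding x y z
    using hyp_cosh_gt_1 pos I by blast+
  obtain p q s where in_plane: "p \<in> hyp_plane" "q \<in> hyp_plane" "s \<in> hyp_plane"
    and pqs: "hyp_dist p q = arcosh x" "hyp_dist p s = arcosh z" "hyp_dist q s = arcosh y"
    using hyp_triangle_exists[OF xyz nondeg] .
  have nondeg': "(z * x - y)\<^sup>2 < (z\<^sup>2 - 1) * (x\<^sup>2 - 1)" using nondeg by (simp add: mult.commute)
  have sym: "hyp_angle_of_cosh z x y = hyp_angle_of_cosh x z y"
    by (simp add: hyp_angle_of_cosh_def mult.commute)
  show ?thesis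
  proof (rule inner_angle_eqI[OF refl distinct hyp_dist_commute _ in_plane])
    show "hyp_length I r u v = hyp_length I r v u" for u v
      by (simp add: hyp_length_def insert_commute mult_ac add_ac)
    show "hyp_dist p q = hyp_length I r i j" "hyp_dist p s = hyp_length I r i k" "hyp_dist q s = hyp_length I r j k"
      unfolding hyp_length_eq pqs x y z by (rule refl)+
    fix p' q' s'
    assume in': "p' \<in> hyp_plane" "q' \<in> hyp_plane" "s' \<in> hyp_plane"
      and "hyp_dist p' q' = hyp_length I r i j" "hyp_dist p' s' = hyp_length I r i k" "hyp_dist q' s' = hyp_length I r j k"
    then have d: "hyp_dist p' q' = arcosh x" "hyp_dist p' s' = arcosh z" "hyp_dist q' s' = arcosh y"
      unfolding hyp_length_eq x y z by auto
    show "hyp_angle p' q' s' = hyp_angle_of_cosh x z y \<and> hyp_angle p' s' q' = hyp_angle_of_cosh x z y"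
      using hyp_angle_eq[OF in' d xyz nondeg] hyp_angle_eq[OF in'(1,3,2) d(2,1) _ xyz(3,2,1) nondeg'] d(3) sym
      by (simp add: hyp_dist_commute)
  qed
qed

lemma eucl_angle_of_squares_scale:
  assumes "\<kappa> \<noteq> 0"
  shows "eucl_angle_of_squares (\<kappa>\<^sup>2 * x) (\<kappa>\<^sup>2 * z) (\<kappa>\<^sup>2 * y) = eucl_angle_of_squares x z y"
proof -
  have "sqrt (\<kappa>\<^sup>2 * x * (\<kappa>\<^sup>2 * z)) = \<kappa>\<^sup>2 * sqrt (x * z)"
    by (simp add: real_sqrt_mult power2_eq_square)
  moreover have "(\<kappa>\<^sup>2 * x + \<kappa>\<^sup>2 * z - \<kappa>\<^sup>2 * y) / 2 = \<kappa>\<^sup>2 * ((x + z - y) / 2)" by (simp add: algebra_simps)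
  ultimately show ?thesis
    unfolding eucl_angle_of_squares_def clamped_angle_def using assms by (simp only:) simp
qed

text \<open>If the radii change by a common factor, the angles are unchanged and the sum is 0; otherwise \<open>eucl_face_monotone\<close> applies.\<close>

lemma eucl_face_energy:
  assumes f: "f \<in> F" "card f = 3" and I: "\<And>e. e \<subseteq> f \<Longrightarrow> card e = 2 \<Longrightarrow> -1 < I e"
    and struct: "\<And>i j k. {i, j, k} = f \<Longrightarrow> 0 \<le> I {i, j} + I {i, k} * I {j, k}"
    and r: "\<forall>v\<in>f. r v > 0" "strict_triangle_ineqs F (eucl_length I r)"
    and s: "\<forall>v\<in>f. s v > 0" "strict_triangle_ineqs F (eucl_length I s)"
  defines "L \<equiv> \<lambda>v. ln (s v) - ln (r v)"
  defines "\<Phi> \<equiv> \<Sum>v\<in>f. L v * (inner_angle UNIV dist eucl_angle (eucl_length I s) f v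
      - inner_angle UNIV dist eucl_angle (eucl_length I r) f v)"
  shows "\<Phi> < 0 \<or> \<Phi> = 0 \<and> (\<forall>u\<in>f. \<forall>v\<in>f. L u = L v)"
proof -
  obtain i j k where fijk: "f = {i, j, k}" and d: "i \<noteq> j" "i \<noteq> k" "j \<noteq> k"
    using f(2) by (metis card_3_iff)
  define a b c where "a = I {i, j}" and "b = I {j, k}" and "c = I {i, k}"
  have Igt: "-1 < I {i, j}" "-1 < I {i, k}" "-1 < I {j, k}" "-1 < I {j, i}" "-1 < I {k, i}" "-1 < I {k, j}"
    using d by (auto intro!: I simp: fijk)
  have I_commute: "I {j, i} = a" "I {k, j} = b" "I {k, i} = c" by (simp_all add: a_def b_def c_def insert_commute)
  interpret inversive_triple a b c
    using Igt struct[of i j k] struct[of i k j] struct[of j k i]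
    by unfold_locales (auto simp: a_def b_def c_def fijk insert_commute mult.commute)
  have tri: "((eucl_square a (\<rho> i) (\<rho> j) + eucl_square c (\<rho> i) (\<rho> k) - eucl_square b (\<rho> j) (\<rho> k)) / 2)\<^sup>2
      < eucl_square a (\<rho> i) (\<rho> j) * eucl_square c (\<rho> i) (\<rho> k)"
    and ang: "inner_angle UNIV dist eucl_angle (eucl_length I \<rho>) f i = eucl_angle_of_squares
        (eucl_square a (\<rho> i) (\<rho> j)) (eucl_square c (\<rho> i) (\<rho> k)) (eucl_square b (\<rho> j) (\<rho> k))"
      "inner_angle UNIV dist eucl_angle (eucl_length I \<rho>) f j = eucl_angle_of_squares
        (eucl_square a (\<rho> i) (\<rho> j)) (eucl_square b (\<rho> j) (\<rho> k)) (eucl_square c (\<rho> i) (\<rho> k))"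
      "inner_angle UNIV dist eucl_angle (eucl_length I \<rho>) f k = eucl_angle_of_squares
        (eucl_square c (\<rho> i) (\<rho> k)) (eucl_square b (\<rho> j) (\<rho> k)) (eucl_square a (\<rho> i) (\<rho> j))"
    if \<rho>: "\<forall>v\<in>f. \<rho> v > 0" "strict_triangle_ineqs F (eucl_length I \<rho>)" for \<rho>
  proof -
    define x y z where "x = eucl_square a (\<rho> i) (\<rho> j)" and "y = eucl_square b (\<rho> j) (\<rho> k)"
      and "z = eucl_square c (\<rho> i) (\<rho> k)"
    have p: "0 < \<rho> i" "0 < \<rho> j" "0 < \<rho> k" using \<rho>(1) fijk by auto
    have xyz: "0 < x" "0 < y" "0 < z" unfolding x_def y_def z_def
      using eucl_square_pos p gt by (meson le_less_trans zero_le_power2)+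
    have "sqrt x < sqrt z + sqrt y" "sqrt z < sqrt x + sqrt y" "sqrt y < sqrt x + sqrt z"
      using \<rho>(2) f(1) unfolding strict_triangle_ineqs_def fijk eucl_length_eq x_def y_def z_def a_def b_def c_def
      by blast+
    note t = this
    have n1: "((x + z - y) / 2)\<^sup>2 < x * z" by (rule eucl_nondegenerate[OF xyz t])
    then show "((eucl_square a (\<rho> i) (\<rho> j) + eucl_square c (\<rho> i) (\<rho> k) - eucl_square b (\<rho> j) (\<rho> k)) / 2)\<^sup>2
      < eucl_square a (\<rho> i) (\<rho> j) * eucl_square c (\<rho> i) (\<rho> k)" by (simp only: x_def y_def z_def)
    have n2: "((x + y - z) / 2)\<^sup>2 < x * y" and n3: "((z + y - x) / 2)\<^sup>2 < z * y"
      using n1 by (simp_all add: power2_eq_square field_simps)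
    have com: "eucl_square a (\<rho> j) (\<rho> i) = x" "eucl_square c (\<rho> k) (\<rho> i) = z" "eucl_square b (\<rho> k) (\<rho> j) = y"
      by (simp_all add: x_def y_def z_def)
    show "inner_angle UNIV dist eucl_angle (eucl_length I \<rho>) f i = eucl_angle_of_squares
        (eucl_square a (\<rho> i) (\<rho> j)) (eucl_square c (\<rho> i) (\<rho> k)) (eucl_square b (\<rho> j) (\<rho> k))"
      unfolding fijk by (rule eucl_inner_angle[OF d p Igt(1-3)])
        (use n1 in \<open>simp_all only: x_def y_def z_def a_def b_def c_def\<close>)
    have "inner_angle UNIV dist eucl_angle (eucl_length I \<rho>) {j, i, k} j = eucl_angle_of_squares x y z"
      by (rule eucl_inner_angle[OF d(1)[symmetric] d(3) d(2) p(2,1,3) Igt(4,3,2)])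
        (use n2 in \<open>simp_all only: com I_commute x_def[symmetric] y_def[symmetric] z_def[symmetric] a_def[symmetric] b_def[symmetric] c_def[symmetric]\<close>)
    then show "inner_angle UNIV dist eucl_angle (eucl_length I \<rho>) f j = eucl_angle_of_squares
        (eucl_square a (\<rho> i) (\<rho> j)) (eucl_square b (\<rho> j) (\<rho> k)) (eucl_square c (\<rho> i) (\<rho> k))"
      unfolding fijk x_def y_def z_def by (simp only: insert_commute)
    have "inner_angle UNIV dist eucl_angle (eucl_length I \<rho>) {k, i, j} k = eucl_angle_of_squares z y x"
      by (rule eucl_inner_angle[OF d(2)[symmetric] d(3)[symmetric] d(1) p(3,1,2) Igt(5,6,1)])
        (use n3 in \<open>simp_all only: com I_commute x_def[symmetric] y_def[symmetric] z_def[symmetric] a_def[symmetric] b_def[symmetric] c_def[symmetric]\<close>)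
    then show "inner_angle UNIV dist eucl_angle (eucl_length I \<rho>) f k = eucl_angle_of_squares
        (eucl_square c (\<rho> i) (\<rho> k)) (eucl_square b (\<rho> j) (\<rho> k)) (eucl_square a (\<rho> i) (\<rho> j))"
      unfolding fijk x_def y_def z_def by (simp only: insert_commute)
  qed
  have three: "(\<Sum>v\<in>f. h v) = h i + h j + h k" for h :: "'a \<Rightarrow> real" using d by (simp add: fijk)
  have p: "0 < r i" "0 < r j" "0 < r k" "0 < s i" "0 < s j" "0 < s k" using r(1) s(1) fijk by auto
  show ?thesis
  proof (cases "L i \<noteq> L j \<or> L j \<noteq> L k")
    case True
    from eucl_face_monotone[OF p refl refl refl refl refl refl tri[OF r] True[unfolded L_def]]
    have "\<Phi> < 0" unfolding \<Phi>_def three ang[OF r] ang[OF s] right_diff_distrib L_def by linarith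
    then show ?thesis ..
  next
    case False
    then have L: "L j = L i" "L k = L i" by simp_all
    define \<kappa> where "\<kappa> = exp (L i)"
    have "s v = \<kappa> * r v" if "L v = L i" "0 < r v" "0 < s v" for v
    proof -
      have "ln (s v) = L i + ln (r v)" using that(1) by (simp add: L_def)
      then have "s v = exp (L i + ln (r v))" using that(3) by (metis exp_ln)
      then show ?thesis using that(2) by (simp add: exp_add \<kappa>_def)
    qed
    then have sr: "s i = \<kappa> * r i" "s j = \<kappa> * r j" "s k = \<kappa> * r k" using L p by simp_all
    have scale: "eucl_square e (\<kappa> * t) (\<kappa> * t') = \<kappa>\<^sup>2 * eucl_square e t t'" for e t t'
      by (simp add: power2_eq_square algebra_simps)
    have "\<Phi> = 0"
      unfolding \<Phi>_def three ang[OF r] ang[OF s] sr scale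
      by (simp add: eucl_angle_of_squares_scale \<kappa>_def)
    moreover have "\<forall>u\<in>f. \<forall>v\<in>f. L u = L v" using L by (auto simp: fijk)
    ultimately show ?thesis by blast
  qed
qed

lemma hyp_face_energy:
  assumes f: "f \<in> F" "card f = 3" and I: "\<And>e. e \<subseteq> f \<Longrightarrow> card e = 2 \<Longrightarrow> -1 < I e"
    and struct: "\<And>i j k. {i, j, k} = f \<Longrightarrow> 0 \<le> I {i, j} + I {i, k} * I {j, k}"
    and r: "\<forall>v\<in>f. r v > 0" "strict_triangle_ineqs F (hyp_length I r)"
    and s: "\<forall>v\<in>f. s v > 0" "strict_triangle_ineqs F (hyp_length I s)"
    and u: "\<And>t. u t = - arsinh (1 / sinh t)"
  defines "\<Phi> \<equiv> \<Sum>v\<in>f. (u (s v) - u (r v)) * (inner_angle hyp_plane hyp_dist hyp_angle (hyp_length I s) f v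
      - inner_angle hyp_plane hyp_dist hyp_angle (hyp_length I r) f v)"
  shows "\<Phi> < 0 \<or> \<Phi> = 0 \<and> (\<forall>v\<in>f. u (s v) = u (r v))"
proof -
  obtain i j k where fijk: "f = {i, j, k}" and d: "i \<noteq> j" "i \<noteq> k" "j \<noteq> k"
    using f(2) by (metis card_3_iff)
  define a b c where "a = I {i, j}" and "b = I {j, k}" and "c = I {i, k}"
  have Igt: "-1 < I {i, j}" "-1 < I {i, k}" "-1 < I {j, k}" "-1 < I {j, i}" "-1 < I {k, i}" "-1 < I {k, j}"
    using d by (auto intro!: I simp: fijk)
  have I_commute: "I {j, i} = a" "I {k, j} = b" "I {k, i} = c" by (simp_all add: a_def b_def c_def insert_commute)
  interpret inversive_triple a b c
    using Igt struct[of i j k] struct[of i k j] struct[of j k i]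
    by unfold_locales (auto simp: a_def b_def c_def fijk insert_commute mult.commute)
  have tri: "((hyp_cosh a (\<rho> i) (\<rho> j)) * (hyp_cosh c (\<rho> i) (\<rho> k)) - (hyp_cosh b (\<rho> j) (\<rho> k)))\<^sup>2
      < ((hyp_cosh a (\<rho> i) (\<rho> j))\<^sup>2 - 1) * ((hyp_cosh c (\<rho> i) (\<rho> k))\<^sup>2 - 1)"
    and ang: "inner_angle hyp_plane hyp_dist hyp_angle (hyp_length I \<rho>) f i = hyp_angle_of_cosh
        (hyp_cosh a (\<rho> i) (\<rho> j)) (hyp_cosh c (\<rho> i) (\<rho> k)) (hyp_cosh b (\<rho> j) (\<rho> k))"
      "inner_angle hyp_plane hyp_dist hyp_angle (hyp_length I \<rho>) f j = hyp_angle_of_cosh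
        (hyp_cosh a (\<rho> i) (\<rho> j)) (hyp_cosh b (\<rho> j) (\<rho> k)) (hyp_cosh c (\<rho> i) (\<rho> k))"
      "inner_angle hyp_plane hyp_dist hyp_angle (hyp_length I \<rho>) f k = hyp_angle_of_cosh
        (hyp_cosh c (\<rho> i) (\<rho> k)) (hyp_cosh b (\<rho> j) (\<rho> k)) (hyp_cosh a (\<rho> i) (\<rho> j))"
    if \<rho>: "\<forall>v\<in>f. \<rho> v > 0" "strict_triangle_ineqs F (hyp_length I \<rho>)" for \<rho>
  proof -
    define x y z where "x = hyp_cosh a (\<rho> i) (\<rho> j)" and "y = hyp_cosh b (\<rho> j) (\<rho> k)"
      and "z = hyp_cosh c (\<rho> i) (\<rho> k)"
    have p: "0 < \<rho> i" "0 < \<rho> j" "0 < \<rho> k" using \<rho>(1) fijk by auto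
    have xyz: "1 < x" "1 < y" "1 < z" unfolding x_def y_def z_def
      using hyp_cosh_gt_1 p gt by blast+
    have "arcosh x < arcosh z + arcosh y" "arcosh z < arcosh x + arcosh y" "arcosh y < arcosh x + arcosh z"
      using \<rho>(2) f(1) unfolding strict_triangle_ineqs_def fijk hyp_length_eq x_def y_def z_def a_def b_def c_def
      by blast+
    note t = this
    have n1: "(x * z - y)\<^sup>2 < (x\<^sup>2 - 1) * (z\<^sup>2 - 1)" by (rule hyp_nondegenerate[OF xyz t])
    then show "((hyp_cosh a (\<rho> i) (\<rho> j)) * (hyp_cosh c (\<rho> i) (\<rho> k)) - (hyp_cosh b (\<rho> j) (\<rho> k)))\<^sup>2
      < ((hyp_cosh a (\<rho> i) (\<rho> j))\<^sup>2 - 1) * ((hyp_cosh c (\<rho> i) (\<rho> k))\<^sup>2 - 1)" by (simp only: x_def y_def z_def)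
    have n2: "(x * y - z)\<^sup>2 < (x\<^sup>2 - 1) * (y\<^sup>2 - 1)" and n3: "(z * y - x)\<^sup>2 < (z\<^sup>2 - 1) * (y\<^sup>2 - 1)"
      using n1 by (simp_all add: power2_eq_square algebra_simps)
    have com: "hyp_cosh a (\<rho> j) (\<rho> i) = x" "hyp_cosh c (\<rho> k) (\<rho> i) = z" "hyp_cosh b (\<rho> k) (\<rho> j) = y"
      by (simp_all add: x_def y_def z_def)
    show "inner_angle hyp_plane hyp_dist hyp_angle (hyp_length I \<rho>) f i = hyp_angle_of_cosh
        (hyp_cosh a (\<rho> i) (\<rho> j)) (hyp_cosh c (\<rho> i) (\<rho> k)) (hyp_cosh b (\<rho> j) (\<rho> k))"
      unfolding fijk by (rule hyp_inner_angle[OF d p Igt(1-3)])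
        (use n1 in \<open>simp_all only: x_def y_def z_def a_def b_def c_def\<close>)
    have "inner_angle hyp_plane hyp_dist hyp_angle (hyp_length I \<rho>) {j, i, k} j = hyp_angle_of_cosh x y z"
      by (rule hyp_inner_angle[OF d(1)[symmetric] d(3) d(2) p(2,1,3) Igt(4,3,2)])
        (use n2 in \<open>simp_all only: com I_commute x_def[symmetric] y_def[symmetric] z_def[symmetric] a_def[symmetric] b_def[symmetric] c_def[symmetric]\<close>)
    then show "inner_angle hyp_plane hyp_dist hyp_angle (hyp_length I \<rho>) f j = hyp_angle_of_cosh
        (hyp_cosh a (\<rho> i) (\<rho> j)) (hyp_cosh b (\<rho> j) (\<rho> k)) (hyp_cosh c (\<rho> i) (\<rho> k))"
      unfolding fijk x_def y_def z_def by (simp only: insert_commute)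
    have "inner_angle hyp_plane hyp_dist hyp_angle (hyp_length I \<rho>) {k, i, j} k = hyp_angle_of_cosh z y x"
      by (rule hyp_inner_angle[OF d(2)[symmetric] d(3)[symmetric] d(1) p(3,1,2) Igt(5,6,1)])
        (use n3 in \<open>simp_all only: com I_commute x_def[symmetric] y_def[symmetric] z_def[symmetric] a_def[symmetric] b_def[symmetric] c_def[symmetric]\<close>)
    then show "inner_angle hyp_plane hyp_dist hyp_angle (hyp_length I \<rho>) f k = hyp_angle_of_cosh
        (hyp_cosh c (\<rho> i) (\<rho> k)) (hyp_cosh b (\<rho> j) (\<rho> k)) (hyp_cosh a (\<rho> i) (\<rho> j))"
      unfolding fijk x_def y_def z_def by (simp only: insert_commute)
  qed
  have three: "(\<Sum>v\<in>f. h v) = h i + h j + h k" for h :: "'a \<Rightarrow> real" using d by (simp add: fijk)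
  have p: "0 < r i" "0 < r j" "0 < r k" "0 < s i" "0 < s j" "0 < s k" using r(1) s(1) fijk by auto
  show ?thesis
  proof (cases "u (s i) \<noteq> u (r i) \<or> u (s j) \<noteq> u (r j) \<or> u (s k) \<noteq> u (r k)")
    case True
    from hyp_face_monotone[OF p refl refl refl refl refl refl tri[OF r] u True]
    have "\<Phi> < 0" unfolding \<Phi>_def three ang[OF r] ang[OF s] right_diff_distrib by linarith
    then show ?thesis ..
  next
    case False
    then have "\<Phi> = 0" unfolding \<Phi>_def three by simp
    moreover have "\<forall>v\<in>f. u (s v) = u (r v)" using False by (auto simp: fijk)
    ultimately show ?thesis by blast
  qed
qed

section \<open>From faces to the surface\<close>

text \<open>Exchanging the two summations collects the angles at each vertex, so that only differences of curvatures remain.\<close>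

lemma curvature_energy:
  fixes w :: "'v \<Rightarrow> real"
  assumes fin: "finite F" "\<And>f. f \<in> F \<Longrightarrow> finite f"
    and eq: "\<And>v. v \<in> \<Union>F \<Longrightarrow> curvature \<theta> F v = curvature \<theta>' F v"
  shows "(\<Sum>f\<in>F. \<Sum>v\<in>f. w v * (\<theta>' f v - \<theta> f v)) = 0"
proof -
  have finU: "finite (\<Union>F)" using fin by blast
  have "(\<Sum>f\<in>F. \<Sum>v\<in>f. w v * (\<theta>' f v - \<theta> f v))
      = (\<Sum>f\<in>F. \<Sum>v | v \<in> \<Union>F \<and> v \<in> f. w v * (\<theta>' f v - \<theta> f v))"
    by (intro sum.cong refl) auto
  also have "\<dots> = (\<Sum>v\<in>\<Union>F. \<Sum>f | f \<in> F \<and> v \<in> f. w v * (\<theta>' f v - \<theta> f v))"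
    by (rule sum.swap_restrict[OF fin(1) finU])
  also have "\<dots> = (\<Sum>v\<in>\<Union>F. w v * (curvature \<theta> F v - curvature \<theta>' F v))"
    by (intro sum.cong refl) (simp add: curvature_def sum_distrib_left sum_subtractf right_diff_distrib)
  also have "\<dots> = 0" using eq by simp
  finally show ?thesis .
qed

text \<open>This is how the connectedness of the surface enters. If the vertices with the value \<open>\<rho> u\<close> were not all vertices,
  then the sum of the barycentric coordinates at these vertices would be a continuous function on the
  realization that is 1 on some faces, 0 on the others, and takes both values.\<close>

lemma constant_of_constant_on_faces:
  fixes \<rho> :: "'v \<Rightarrow> 'c"
  assumes surface: "closed_surface M" and tri: "triangulation_of M V E F"
    and const: "\<And>f u v. f \<in> F \<Longrightarrow> u \<in> f \<Longrightarrow> v \<in> f \<Longrightarrow> \<rho> u = \<rho> v"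
    and uv: "u \<in> V" "v \<in> V"
  shows "\<rho> u = \<rho> v"
proof (rule ccontr)
  assume ne: "\<rho> u \<noteq> \<rho> v"
  note tri = tri[unfolded triangulation_of_def]
  have V: "finite V" "V = \<Union>F" by (rule tri[THEN conjunct1], rule tri[THEN conjunct2, THEN conjunct1])
  have F: "\<And>f. f \<in> F \<Longrightarrow> card f = 3"
    by (rule bspec[OF tri[THEN conjunct2, THEN conjunct2, THEN conjunct1]])
  have homeo: "top_of_set (realization F) homeomorphic_space M"
    by (rule tri[THEN conjunct2, THEN conjunct2, THEN conjunct2, THEN conjunct2])
  have "connected_space M" using surface unfolding closed_surface_def by blast
  then have "connected_space (top_of_set (realization F))"
    unfolding homeomorphic_connected_space[OF homeo] .
  then have conn: "connected (realization F)"
    unfolding connectedin_iff_connected[symmetric] connectedin_def by simp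
  define V1 where "V1 = {w \<in> V. \<rho> w = \<rho> u}"
  define \<phi> where "\<phi> = (\<lambda>x :: 'v \<Rightarrow> real. \<Sum>w\<in>V1. x w)"
  have "continuous_on (realization F) (\<lambda>x. x w)" for w :: 'v
    by (rule continuous_on_subset[OF continuous_on_product_coordinates]) simp
  then have "continuous_on (realization F) \<phi>" unfolding \<phi>_def by (rule continuous_on_sum)
  then have conn\<phi>: "connected (\<phi> ` realization F)" using conn by (rule connected_continuous_image)
  have vertex: "(\<lambda>w'. if w' = w then 1 else 0) \<in> realization F" if "w \<in> V" for w
  proof -
    obtain f where f: "f \<in> F" "w \<in> f" using \<open>w \<in> V\<close> unfolding V(2) by (rule UnionE)
    have "finite f" using F[OF f(1)] card_ge_0_finite[of f] by simp
    then have "(\<Sum>w'\<in>f. if w' = w then 1 else (0 :: real)) = 1" using f(2) by simp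
    then show ?thesis unfolding realization_def using f by (intro UN_I[OF f(1)] CollectI conjI allI impI) auto
  qed
  have zero_one: "\<phi> x = 0 \<or> \<phi> x = 1" if x_in: "x \<in> realization F" for x
  proof -
    obtain f where f: "f \<in> F" and x: "\<forall>w. w \<notin> f \<longrightarrow> x w = 0" "(\<Sum>w\<in>f. x w) = 1"
      using x_in unfolding realization_def by (elim UN_E CollectE conjE)
    have "f \<subseteq> V" unfolding V(2) by (rule Union_upper[OF f])
    have "f \<subseteq> V1 \<or> f \<inter> V1 = {}"
    proof (cases "\<exists>w\<in>f. \<rho> w = \<rho> u")
      case True
      then obtain w where w: "w \<in> f" "\<rho> w = \<rho> u" by (elim bexE)
      have "\<rho> w' = \<rho> u" if "w' \<in> f" for w' using const[OF f that w(1)] w(2) by (rule trans)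
      with \<open>f \<subseteq> V\<close> have "f \<subseteq> V1" by (auto simp: V1_def)
      then show ?thesis ..
    next
      case False
      then have "f \<inter> V1 = {}" by (auto simp: V1_def)
      then show ?thesis ..
    qed
    then show ?thesis
    proof
      assume "f \<subseteq> V1"
      have "finite V1" using V(1) by (simp add: V1_def)
      then have "(\<Sum>w\<in>f. x w) = \<phi> x"
        unfolding \<phi>_def using \<open>f \<subseteq> V1\<close> by (rule sum.mono_neutral_left) (use x(1) in blast)
      then show ?thesis using x(2) by simp
    next
      assume "f \<inter> V1 = {}"
      then have "\<phi> x = 0" unfolding \<phi>_def by (intro sum.neutral) (use x(1) in blast)
      then show ?thesis ..
    qed
  qed
  have "finite V1" "u \<in> V1" "v \<notin> V1" using V(1) uv ne by (simp_all add: V1_def)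
  then have "\<phi> (\<lambda>w'. if w' = u then 1 else 0) = 1" "\<phi> (\<lambda>w'. if w' = v then 1 else 0) = 0"
    by (simp_all add: \<phi>_def)
  then have "1 \<in> \<phi> ` realization F" "0 \<in> \<phi> ` realization F"
    using imageI[OF vertex[OF uv(1)], of \<phi>] imageI[OF vertex[OF uv(2)], of \<phi>] by simp_all
  then have "1 / 2 \<in> \<phi> ` realization F"
    using connectedD_interval[OF conn\<phi>, of 0 1 "1 / 2"] by simp
  then obtain x where "x \<in> realization F" "\<phi> x = 1 / 2" by auto
  then show False using zero_one[of x] by simp
qed

lemma all_zero_of_sum_zero:
  fixes \<Phi> :: "'b \<Rightarrow> real"
  assumes "finite F" "(\<Sum>f\<in>F. \<Phi> f) = 0" "\<And>f. f \<in> F \<Longrightarrow> \<Phi> f < 0 \<or> \<Phi> f = 0 \<and> Q f" and "f \<in> F"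
  shows "Q f"
proof -
  have "0 \<le> - \<Phi> f" if "f \<in> F" for f using assms(3)[OF that] by auto
  moreover have "(\<Sum>f\<in>F. - \<Phi> f) = 0" using assms(2) by (simp add: sum_negf)
  ultimately have "\<Phi> f = 0" using sum_nonneg_eq_0_iff[OF assms(1), of "\<lambda>f. - \<Phi> f"] assms(4) by simp
  then show ?thesis using assms(3)[OF assms(4)] by simp
qed

theorem theorem1p1:
  fixes M :: "'m topology"
    and V :: "'v set" and E F :: "'v set set"
    and I :: "'v set \<Rightarrow> real"
  assumes "closed_surface M"
    and "triangulation_of M V E F"
    and "\<forall>e\<in>E. I e > -1"
    and "\<forall>i j k. {i, j, k} \<in> F \<longrightarrow>
           I {i, j} + I {i, k} * I {j, k} \<ge> 0 \<and>
           I {i, k} + I {i, j} * I {j, k} \<ge> 0 \<and>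
           I {j, k} + I {i, j} * I {i, k} \<ge> 0"
  shows "(\<forall>r r'. eucl_packing_metric V F I r \<and> eucl_packing_metric V F I r' \<and>
             (\<forall>v\<in>V. eucl_curvature F I r v = eucl_curvature F I r' v) \<longrightarrow>
             (\<exists>c>0. \<forall>v\<in>V. r' v = c * r v)) \<and>
         (\<forall>r r'. hyp_packing_metric V F I r \<and> hyp_packing_metric V F I r' \<and>
             (\<forall>v\<in>V. hyp_curvature F I r v = hyp_curvature F I r' v) \<longrightarrow>
             (\<forall>v\<in>V. r' v = r v))"
proof -
  note tri = assms(2)[unfolded triangulation_of_def]
  have finV: "finite V" and V: "V = \<Union>F" by (rule tri[THEN conjunct1], rule tri[THEN conjunct2, THEN conjunct1])
  have card3: "\<And>f. f \<in> F \<Longrightarrow> card f = 3"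
    by (rule bspec[OF tri[THEN conjunct2, THEN conjunct2, THEN conjunct1]])
  have E: "E = {e. card e = 2 \<and> (\<exists>f\<in>F. e \<subseteq> f)}"
    by (rule tri[THEN conjunct2, THEN conjunct2, THEN conjunct2, THEN conjunct1])
  have finF: "finite F" using finV V by (metis finite_UnionD)
  have finf: "finite f" if "f \<in> F" for f using card3[OF that] card_ge_0_finite[of f] by simp
  have fV: "v \<in> V" if "f \<in> F" "v \<in> f" for f v unfolding V using that by (rule UnionI)
  have I: "-1 < I e" if "f \<in> F" "e \<subseteq> f" "card e = 2" for f e using assms(3) that unfolding E by auto
  have struct: "0 \<le> I {i, j} + I {i, k} * I {j, k}" if "f \<in> F" "{i, j, k} = f" for f i j k
    using assms(4)[rule_format, of i j k] that by simp
  have eucl: "\<exists>c>0. \<forall>v\<in>V. r' v = c * r v"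
    if r: "eucl_packing_metric V F I r" and r': "eucl_packing_metric V F I r'"
      and K: "\<forall>v\<in>V. eucl_curvature F I r v = eucl_curvature F I r' v" for r r'
  proof -
    define L where "L = (\<lambda>v. ln (r' v) - ln (r v))"
    define \<Phi> where "\<Phi> = (\<lambda>f. \<Sum>v\<in>f. L v * (inner_angle UNIV dist eucl_angle (eucl_length I r') f v
      - inner_angle UNIV dist eucl_angle (eucl_length I r) f v))"
    have pos: "0 < r v" "0 < r' v" if "v \<in> V" for v using r r' that by (simp_all add: eucl_packing_metric_def)
    have "(\<Sum>f\<in>F. \<Phi> f) = 0"
      unfolding \<Phi>_def by (rule curvature_energy[OF finF finf bspec[OF K[unfolded eucl_curvature_def V]]])
    moreover have "\<Phi> f < 0 \<or> \<Phi> f = 0 \<and> (\<forall>u\<in>f. \<forall>v\<in>f. L u = L v)" if f: "f \<in> F" for f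
      unfolding \<Phi>_def L_def
    proof (rule eucl_face_energy[where F = F and I = I and r = r and s = r', OF f card3[OF f]])
      show "\<forall>v\<in>f. 0 < r v" "\<forall>v\<in>f. 0 < r' v" using pos fV[OF f] by simp_all
      show "strict_triangle_ineqs F (eucl_length I r)" "strict_triangle_ineqs F (eucl_length I r')"
        using r r' by (simp_all add: eucl_packing_metric_def)
    qed (rule I[OF f] struct[OF f] ; assumption?)+
    ultimately have const: "\<forall>u\<in>f. \<forall>v\<in>f. L u = L v" if "f \<in> F" for f
      using all_zero_of_sum_zero[OF finF _ _ that, of \<Phi> "\<lambda>f. \<forall>u\<in>f. \<forall>v\<in>f. L u = L v"] by blast
    have L_const: "L u = L v" if "u \<in> V" "v \<in> V" for u v
      by (rule constant_of_constant_on_faces[OF assms(1,2) _ that]) (use const in blast)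
    obtain l where l: "\<And>v. v \<in> V \<Longrightarrow> L v = l" using L_const by (cases "V = {}") (blast, metis ex_in_conv)
    have "r' v = exp l * r v" if "v \<in> V" for v
    proof -
      have "ln (r' v) = l + ln (r v)" using l[OF that] by (simp add: L_def)
      then have "r' v = exp (l + ln (r v))" using pos[OF that] by (metis exp_ln)
      then show ?thesis using pos[OF that] by (simp add: exp_add)
    qed
    then show ?thesis by (intro exI[of _ "exp l"]) simp
  qed
  have hyp: "\<forall>v\<in>V. r' v = r v"
    if r: "hyp_packing_metric V F I r" and r': "hyp_packing_metric V F I r'"
      and K: "\<forall>v\<in>V. hyp_curvature F I r v = hyp_curvature F I r' v" for r r'
  proof
    fix v assume "v \<in> V"
    define u :: "real \<Rightarrow> real" where "u = (\<lambda>t. - arsinh (1 / sinh t))"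
    define \<Phi> where "\<Phi> = (\<lambda>f. \<Sum>v\<in>f. (u (r' v) - u (r v)) * (inner_angle hyp_plane hyp_dist hyp_angle (hyp_length I r') f v
      - inner_angle hyp_plane hyp_dist hyp_angle (hyp_length I r) f v))"
    have pos: "0 < r v" "0 < r' v" if "v \<in> V" for v using r r' that by (simp_all add: hyp_packing_metric_def)
    have "(\<Sum>f\<in>F. \<Phi> f) = 0"
      unfolding \<Phi>_def by (rule curvature_energy[OF finF finf bspec[OF K[unfolded hyp_curvature_def V]]])
    moreover have "\<Phi> f < 0 \<or> \<Phi> f = 0 \<and> (\<forall>v\<in>f. u (r' v) = u (r v))" if f: "f \<in> F" for f
      unfolding \<Phi>_def
    proof (rule hyp_face_energy[where F = F and I = I and r = r and s = r', OF f card3[OF f]])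
      show "\<forall>v\<in>f. 0 < r v" "\<forall>v\<in>f. 0 < r' v" using pos fV[OF f] by simp_all
      show "strict_triangle_ineqs F (hyp_length I r)" "strict_triangle_ineqs F (hyp_length I r')"
        using r r' by (simp_all add: hyp_packing_metric_def)
    qed (rule I[OF f] struct[OF f] u_def[THEN fun_cong]; assumption?)+
    ultimately have const: "\<forall>v\<in>f. u (r' v) = u (r v)" if "f \<in> F" for f
      using all_zero_of_sum_zero[OF finF _ _ that, of \<Phi> "\<lambda>f. \<forall>v\<in>f. u (r' v) = u (r v)"] by blast
    obtain f where "f \<in> F" "v \<in> f" using \<open>v \<in> V\<close> unfolding V by (rule UnionE)
    then have "u (r' v) = u (r v)" using const by blast
    then have "sinh (u (r' v)) = sinh (u (r v))" by simp
    then have "sinh (r' v) = sinh (r v)" using pos[OF \<open>v \<in> V\<close>] by (simp add: u_def)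
    then show "r' v = r v" by simp
  qed
  show ?thesis using eucl hyp by blast
qed

end
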